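(* Let $A\in\mathbb{C}^{n\times n}$ be a negative definite Hermitian matrix, let $\mu>|\lambda_{\min}(A)|$, and consider the problem (qTPM) $$\min_{Y\in\mathcal{OB}(n,p)} g_\mu(Y)=\tfrac12\mathrm{tr}(Y^*AY)+\tfrac{\mu}{4}\mathrm{tr}(Y^*YY^*Y).$$ Every stationary point of qTPM is of the form $XP$, where $P$ is a $p\times p$ permutation matrix and $X=(X_1,\dots,X_k)$ for some number $k$ of column blocks, with $X_i\in\mathbb{C}^{n\times p_i}$ of rank $r_i$, $i=1,\dots,k$, having singular value decompositions $X_i=U_i\Sigma_iV_i^*$ with $U_i\in\mathbb{C}^{n\times p_i}$, $\Sigma_i\in\mathbb{R}^{p_i\times p_i}$, $V_i\in\mathbb{C}^{p_i\times p_i}$, so that, with $$U=(U_1,\dots,U_k),\quad \Sigma=\mathrm{diag}(\Sigma_1,\dots,\Sigma_k),\quad V=\mathrm{diag}(V_1,\dots,V_k)$$ (block diagonal), $X=U\Sigma V^*$ and the following conditions hold. 1. $U^*U=I$, and for each $i=1,\dots,k$ the columns of $U_i$ are eigenvectors of $A$ with eigenvalues $\lambda_{i1},\dots,\lambda_{ip_i}$ (the $j$-th column having eigenvalue $\lambda_{ij}$). 2. For $i=1,\dots,k$, $\Sigma_i=\mathrm{diag}(\sigma_{i1},\dots,\sigma_{ip_i})$ with $$\sigma_{ij}=\sqrt{\frac{p_i}{r_i}-\frac1\mu\Big(\lambda_{ij}-\frac1{r_i}\sum_{l=1}^{r_i}\lambda_{il}\Big)}\quad\text{for } j=1,\dots,r_i,\qquad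 \sigma_{ij}=0\quad\text{for } j=r_i+1,\dots,p_i .$$ 3. $V^*V=I$, and each $V_i\in\mathbb{C}^{p_i\times p_i}$ is unitary and such that $X_i\in\mathcal{OB}(n,p_i)$, for $i=1,\dots,k$. Moreover, any $X\in\mathbb{C}^{n\times p}$ satisfying the conditions above is a stationary point of qTPM, and so is $XP$ for an arbitrary permutation matrix $P$.
   Context: Let $1\le p\le n$ be integers. $X^*$ denotes the conjugate transpose, $I$ an identity matrix of suitable size, and $\lambda_{\min}(A)$ the smallest eigenvalue of $A$. The oblique manifold is $\mathcal{OB}(n,p)=\{X\in\mathbb{C}^{n\times p}:\ (X^*X)_{jj}=1 \text{ for } j=1,\dots,p\}$. The diagonal entries of the singular value matrices are not required to be sorted. A stationary point of qTPM is a matrix $X\in\mathcal{OB}(n,p)$ satisfying the first-order condition of the Lagrangian $L(X,D)=\tfrac12\mathrm{tr}(X^*AX)+\tfrac\mu4\mathrm{tr}(X^*XX^*X)+\tfrac12\mathrm{tr}(D^\top(X^*X-I))$, i.e. there is a real diagonal matrix $D=\mathrm{diag}(d_1,\dots,d_p)$ with $$AX+\mu XX^*X+XD=0 .$$ *)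

theory Defs
  imports
    "Jordan_Normal_Form.Schur_Decomposition"
    "Jordan_Normal_Form.DL_Rank"
begin

definition hermitian :: "complex mat \<Rightarrow> bool" where
  "hermitian A \<longleftrightarrow> square_mat A \<and> mat_adjoint A = A"

definition negative_definite :: "complex mat \<Rightarrow> bool" where
  "negative_definite A \<longleftrightarrow>
     (\<forall>x \<in> carrier_vec (dim_row A). x \<noteq> 0\<^sub>v (dim_row A) \<longrightarrow> Re ((A *\<^sub>v x) \<bullet>c x) < 0)"

(* Meant for Hermitian matrices of positive size, whose eigenvalues are all real. *)
definition lambda_min :: "complex mat \<Rightarrow> real" where
  "lambda_min A = Min {l :: real. eigenvalue A (complex_of_real l)}"

definition oblique :: "nat \<Rightarrow> nat \<Rightarrow> complex mat set" where
  "oblique n p = {X \<in> carrier_mat n p. \<forall>j<p. (mat_adjoint X * X) $$ (j, j) = 1}"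

(* First-order condition of the Lagrangian
     1/2 tr (X^* A X) + mu/4 tr (X^* X X^* X) + 1/2 tr (D^T (X^* X - I))
   with real multipliers d 0, ..., d (p-1) for the p normalisation constraints. *)
definition qtpm_stationary :: "complex mat \<Rightarrow> real \<Rightarrow> nat \<Rightarrow> nat \<Rightarrow> complex mat \<Rightarrow> bool" where
  "qtpm_stationary A \<mu> n p X \<longleftrightarrow> X \<in> oblique n p \<and>
     (\<exists>d :: nat \<Rightarrow> real.
        A * X + complex_of_real \<mu> \<cdot>\<^sub>m (X * mat_adjoint X * X)
          + X * mat_diag p (\<lambda>j. complex_of_real (d j)) = 0\<^sub>m n p)"

definition permutation_matrix :: "nat \<Rightarrow> complex mat \<Rightarrow> bool" where
  "permutation_matrix p P \<longleftrightarrow>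
     (\<exists>\<pi>. \<pi> permutes {..<p} \<and> P = mat p p (\<lambda>(i, j). if i = \<pi> j then 1 else 0))"

definition is_unitary :: "nat \<Rightarrow> complex mat \<Rightarrow> bool" where
  "is_unitary m V \<longleftrightarrow> V \<in> carrier_mat m m \<and>
     mat_adjoint V * V = 1\<^sub>m m \<and> V * mat_adjoint V = 1\<^sub>m m"

(* The reduced SVD X = U S V^* of an n x m matrix: U is n x m with orthonormal columns
   and S is square.  The singular values are nonnegative but need not be sorted. *)
definition is_svd ::
  "nat \<Rightarrow> nat \<Rightarrow> complex mat \<Rightarrow> complex mat \<Rightarrow> real mat \<Rightarrow> complex mat \<Rightarrow> bool" where
  "is_svd n m X U S V \<longleftrightarrow>
     U \<in> carrier_mat n m \<and> mat_adjoint U * U = 1\<^sub>m m \<and>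
     S \<in> carrier_mat m m \<and> diagonal_mat S \<and> (\<forall>j<m. S $$ (j, j) \<ge> 0) \<and>
     is_unitary m V \<and>
     X = U * map_mat complex_of_real S * mat_adjoint V"

(* The matrix (B 0, ..., B (k-1)) of column blocks with n rows. *)
definition hcat :: "nat \<Rightarrow> nat \<Rightarrow> (nat \<Rightarrow> complex mat) \<Rightarrow> complex mat" where
  "hcat n k B = mat_of_cols n (concat (map (\<lambda>i. cols (B i)) [0..<k]))"

definition block_diag :: "nat \<Rightarrow> (nat \<Rightarrow> 'a :: zero mat) \<Rightarrow> 'a mat" where
  "block_diag k B = diag_block_mat (map B [0..<k])"

(* Blocks and their columns are indexed from 0; q i is the width and r i the rank of the
   block Xb i, and lam i j is the eigenvalue belonging to column j of U i. *)
definition qtpm_block_conditions ::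
  "complex mat \<Rightarrow> real \<Rightarrow> nat \<Rightarrow> nat \<Rightarrow> complex mat \<Rightarrow>
   nat \<Rightarrow> (nat \<Rightarrow> nat) \<Rightarrow> (nat \<Rightarrow> nat) \<Rightarrow> (nat \<Rightarrow> complex mat) \<Rightarrow>
   (nat \<Rightarrow> complex mat) \<Rightarrow> (nat \<Rightarrow> real mat) \<Rightarrow> (nat \<Rightarrow> complex mat) \<Rightarrow>
   (nat \<Rightarrow> nat \<Rightarrow> real) \<Rightarrow> bool" where
  "qtpm_block_conditions A \<mu> n p X k q r Xb U S V lam \<longleftrightarrow>
     (\<forall>i<k. q i \<ge> 1) \<and> (\<Sum>i<k. q i) = p \<and>
     (\<forall>i<k. Xb i \<in> carrier_mat n (q i) \<and> vec_space.rank n (Xb i) = r i \<and>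
            is_svd n (q i) (Xb i) (U i) (S i) (V i)) \<and>
     X = hcat n k Xb \<and>
     X = hcat n k U * map_mat complex_of_real (block_diag k S) * mat_adjoint (block_diag k V) \<and>
     mat_adjoint (hcat n k U) * hcat n k U = 1\<^sub>m p \<and>
     (\<forall>i<k. \<forall>j<q i. eigenvector A (col (U i) j) (complex_of_real (lam i j))) \<and>
     (\<forall>i<k. S i = mat_diag (q i) (\<lambda>j.
        if j < r i
        then sqrt (real (q i) / real (r i)
               - 1 / \<mu> * (lam i j - 1 / real (r i) * (\<Sum>l<r i. lam i l)))
        else 0)) \<and>
     mat_adjoint (block_diag k V) * block_diag k V = 1\<^sub>m p \<and>
     (\<forall>i<k. is_unitary (q i) (V i) \<and> Xb i \<in> oblique n (q i))"

definition qtpm_block_form :: "complex mat \<Rightarrow> real \<Rightarrow> nat \<Rightarrow> nat \<Rightarrow> complex mat \<Rightarrow> bool" where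
  "qtpm_block_form A \<mu> n p X \<longleftrightarrow>
     (\<exists>k q r Xb U S V lam. qtpm_block_conditions A \<mu> n p X k q r Xb U S V lam)"

end

(*
Stationarity says that every column of Y is an eigenvector of the Hermitian matrix
A + mu Y Y^*, with eigenvalue -d_j.  Grouping the columns by the value of d_j therefore gives
blocks X_i with X_i^* X_j = 0 for distinct i, j, and each block satisfies
A X_i + mu X_i X_i^* X_i = c_i X_i on its own.  If V_i diagonalises X_i^* X_i with eigenvalues
sigma_ij^2, this equation says that the nonzero columns of X_i V_i, which are orthogonal of length
sigma_ij, are eigenvectors of A with eigenvalue lambda_ij = c_i - mu sigma_ij^2.  Since the columns
of X_i are unit vectors, the sigma_ij^2 add up to p_i, which determines c_i and yields the formula
for sigma_ij.  The normalised vectors are completed to an orthonormal system of eigenvectors of A,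
which is possible because p <= n.  The converse reverses the computation.
*)

theory Submission
  imports Defs
begin

text \<open>Write G(X) for A X + \<mu> X X^* X. Two observations decouple the equation. If W is
  unitary, then X W and X have the same product X X^*, so G(X W) = G(X) W; hence columns may be
  permuted freely. And X X^* X = X (X^* X), where the Gram matrix X^* X is block diagonal once
  distinct blocks are orthogonal, so the cubic term does not mix blocks. The delicate point is the
  completion of the U_i. A column belonging to a zero singular value must be an eigenvector of A
  orthogonal to the columns of all blocks, so the blocks cannot be completed separately. The
  completion runs over pairs (i, j), from those with j < r_i up to all p pairs. Each step uses that
  the orthogonal complement of a set of eigenvectors is invariant under A, and that it is nonzero
  while fewer than n vectors have been chosen. Summing lambda_ij = c_i - \<mu> sigma_ij^2 over the
  nonzero singular values gives c_i = (\<mu> p_i + sum of the lambda_ij) / r_i. In the converse this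
  number is read off the formula for sigma_ij. Columns with sigma_ij = 0 impose no condition,
  because they vanish in X_i V_i.\<close>

section \<open>Block matrices\<close>

lemma mat_adjoint_dim [simp]:
  "dim_row (mat_adjoint A) = dim_col A" "dim_col (mat_adjoint A) = dim_row A"
  by (auto simp: mat_adjoint_def)

lemma mat_adjoint_carrier [simp]:
  "A \<in> carrier_mat n m \<Longrightarrow> mat_adjoint A \<in> carrier_mat m n"
  by (rule carrier_matI) simp_all

lemma mat_adjoint_index [simp]:
  fixes A :: "complex mat"
  assumes "i < dim_col A" "j < dim_row A"
  shows "mat_adjoint A $$ (i, j) = cnj (A $$ (j, i))"
  using assms by (simp add: mat_adjoint_def mat_of_rows_def)

lemma mat_mult_index:
  assumes "A \<in> carrier_mat n m" "B \<in> carrier_mat m l" "i < n" "j < l"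
  shows "(A * B) $$ (i, j) = (\<Sum>c<m. A $$ (i, c) * B $$ (c, j))"
  using assms by (auto simp: scalar_prod_def atLeast0LessThan intro!: sum.cong)

lemma mat_adjoint_mult:
  fixes A :: "complex mat"
  assumes "A \<in> carrier_mat n m" "B \<in> carrier_mat m l"
  shows "mat_adjoint (A * B) = mat_adjoint B * mat_adjoint A"
proof (rule eq_matI)
  fix i j
  assume "i < dim_row (mat_adjoint B * mat_adjoint A)" "j < dim_col (mat_adjoint B * mat_adjoint A)"
  then have ij: "i < l" "j < n"
    using assms by auto
  have "mat_adjoint (A * B) $$ (i, j) = cnj ((A * B) $$ (j, i))"
    using assms ij by auto
  also have "\<dots> = (\<Sum>c<m. mat_adjoint B $$ (i, c) * mat_adjoint A $$ (c, j))"
    using assms ij unfolding mat_mult_index[OF assms ij(2,1)]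
    by (auto simp: mult.commute intro!: sum.cong)
  also have "\<dots> = (mat_adjoint B * mat_adjoint A) $$ (i, j)"
    using assms ij by (subst mat_mult_index[of _ l m _ n]) auto
  finally show "mat_adjoint (A * B) $$ (i, j) = (mat_adjoint B * mat_adjoint A) $$ (i, j)" .
qed (use assms in auto)

lemma mat_adjoint_adjoint [simp]: "mat_adjoint (mat_adjoint (A :: complex mat)) = A"
  by (rule eq_matI) auto

text \<open>\<open>\<bullet>c\<close> conjugates its second argument, so the column belonging to the
  row index of the Gram matrix stands on the right.\<close>

lemma gram_index:
  fixes A :: "complex mat"
  assumes "A \<in> carrier_mat n m" "B \<in> carrier_mat n l" "i < m" "j < l"
  shows "(mat_adjoint A * B) $$ (i, j) = col B j \<bullet>c col A i"
proof -
  have "(mat_adjoint A * B) $$ (i, j) = (\<Sum>c<n. cnj (A $$ (c, i)) * B $$ (c, j))"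
    using assms by (subst mat_mult_index[of _ m n _ l]) auto
  also have "\<dots> = col B j \<bullet>c col A i"
    using assms by (auto simp: scalar_prod_def atLeast0LessThan mult.commute intro!: sum.cong)
  finally show ?thesis .
qed

section \<open>Positions of columns in a partition into blocks\<close>

text \<open>Block \<open>i\<close> starts at this position. Global indices are written
  \<open>block_offset q i + a\<close> with \<open>a < q i\<close>, which is how a matrix is compared
  with its blocks below; \<open>block_offset q k\<close> is the total width.\<close>

definition block_offset :: "(nat \<Rightarrow> nat) \<Rightarrow> nat \<Rightarrow> nat" where
  "block_offset q i = (\<Sum>l<i. q l)"

lemma block_offset_Suc [simp]: "block_offset q (Suc i) = block_offset q i + q i"
  by (simp add: block_offset_def)

lemma block_offset_0 [simp]: "block_offset q 0 = 0"
  by (simp add: block_offset_def)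

lemma block_offset_mono: "i \<le> j \<Longrightarrow> block_offset q i \<le> block_offset q j"
  unfolding block_offset_def by (rule sum_mono2) auto

lemma block_index_less:
  assumes "i < k" "a < q i"
  shows "block_offset q i + a < block_offset q k"
  using block_offset_mono[of "Suc i" k q] assms by simp

lemma block_index_inj:
  assumes "a < q i" "b < q j"
  shows "block_offset q i + a = block_offset q j + b \<longleftrightarrow> i = j \<and> a = b"
  using block_index_less[of i j a q] block_index_less[of j i b q] assms
  by (cases i j rule: linorder_cases) auto

lemma block_indexE:
  assumes "c < block_offset q k"
  obtains i a where "i < k" "a < q i" "c = block_offset q i + a"
proof -
  have "\<exists>i a. i < k \<and> a < q i \<and> c = block_offset q i + a"
    using assms
  proof (induction k)
    case (Suc k)
    show ?case
    proof (cases "c < block_offset q k")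
      case True
      then show ?thesis using Suc.IH by (meson less_SucI)
    next
      case False
      then show ?thesis
        using Suc.prems by (intro exI[of _ k] exI[of _ "c - block_offset q k"]) auto
    qed
  qed simp
  then show thesis using that by blast
qed

lemma sum_block_index:
  "(\<Sum>c<block_offset q k. f c) = (\<Sum>i<k. \<Sum>a<q i. f (block_offset q i + a))"
proof (induction k)
  case (Suc k)
  have "(\<Sum>c<m + l. f c) = (\<Sum>c<m. f c) + (\<Sum>a<l. f (m + a))" for m l :: nat
    by (induction l) (auto simp: add.assoc)
  then show ?case using Suc by simp
qed simp

lemma concat_blocks_nth:
  assumes "\<And>i. i < k \<Longrightarrow> length (L i) = q i" "i < k" "a < q i"
  shows "length (concat (map L [0..<k])) = block_offset q k"
    and "concat (map L [0..<k]) ! (block_offset q i + a) = L i ! a"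
proof -
  \<comment> \<open>Stated for every \<open>k\<close>, because the induction for the second claim
    needs the length of the shorter prefix.\<close>
  have len: "length (concat (map L [0..<k])) = block_offset q k" if "\<And>i. i < k \<Longrightarrow> length (L i) = q i" for k
    using that by (induction k) auto
  show "length (concat (map L [0..<k])) = block_offset q k"
    by (rule len) (rule assms(1))
  show "concat (map L [0..<k]) ! (block_offset q i + a) = L i ! a"
    using assms
  proof (induction k)
    case (Suc k)
    have lk: "length (concat (map L [0..<k])) = block_offset q k"
      by (rule len) (use Suc.prems(1) in auto)
    show ?case
    proof (cases "i = k")
      case True
      then show ?thesis using lk by (simp add: nth_append)
    next
      case False
      then have "i < k" using Suc.prems by simp
      then show ?thesis
        using Suc lk block_index_less[of i k a q] by (simp add: nth_append)
    qed
  qed simp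
qed

section \<open>Concatenated and block diagonal matrices\<close>

lemma hcat_carrier:
  assumes "\<And>i. i < k \<Longrightarrow> B i \<in> carrier_mat n (q i)"
  shows "hcat n k B \<in> carrier_mat n (block_offset q k)"
proof -
  have "length (concat (map (\<lambda>i. cols (B i)) [0..<k])) = block_offset q k"
    using assms by (induction k) auto
  then show ?thesis by (simp add: hcat_def carrier_matI)
qed

lemma hcat_index:
  assumes "\<And>i. i < k \<Longrightarrow> B i \<in> carrier_mat n (q i)" "i < k" "a < q i" "x < n"
  shows "hcat n k B $$ (x, block_offset q i + a) = B i $$ (x, a)"
proof -
  note c = concat_blocks_nth[of k "\<lambda>i. cols (B i)" q, OF _ assms(2,3)]
  have len: "length (cols (B i)) = q i" if "i < k" for i
    using assms(1)[OF that] by simp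
  have "B i \<in> carrier_mat n (q i)" using assms by blast
  then show ?thesis
    using c[OF len] assms(2-4) block_index_less[of i k a q, OF assms(2,3)]
    by (simp add: hcat_def mat_of_cols_index)
qed

lemma block_diag_carrier:
  assumes "\<And>i. i < k \<Longrightarrow> B i \<in> carrier_mat (q i) (q i)"
  shows "block_diag k B \<in> carrier_mat (block_offset q k) (block_offset q k)"
proof -
  have "sum_list (map dim_row (map B [0..<k])) = block_offset q k"
       "sum_list (map dim_col (map B [0..<k])) = block_offset q k"
    using assms by (induction k) auto
  then show ?thesis
    by (simp add: block_diag_def carrier_matI dim_diag_block_mat)
qed

text \<open>Splitting off the last block instead of the first leaves the offsets of the other blocks
  unchanged, which suits induction on \<open>k\<close>.\<close>

lemma block_diag_Suc:
  assumes "\<And>i. i \<le> k \<Longrightarrow> B i \<in> carrier_mat (q i) (q i)"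
  shows "block_diag (Suc k) B = four_block_mat (block_diag k B)
     (0\<^sub>m (block_offset q k) (q k)) (0\<^sub>m (q k) (block_offset q k)) (B k)"
proof -
  have 1: "block_diag k B \<in> carrier_mat (block_offset q k) (block_offset q k)"
    using assms by (simp add: block_diag_carrier)
  have 2: "B k \<in> carrier_mat (q k) (q k)" using assms by simp
  show ?thesis
    using 1 2 unfolding block_diag_def by (simp add: diag_block_mat_last Let_def)
qed

lemma block_diag_index:
  assumes "\<And>i. i < k \<Longrightarrow> B i \<in> carrier_mat (q i) (q i)"
    and "i < k" "a < q i" "j < k" "b < q j"
  shows "block_diag k B $$ (block_offset q i + a, block_offset q j + b) =
    (if i = j then B i $$ (a, b) else 0)"
  using assms
proof (induction k)
  case (Suc k)
  have 1: "block_diag k B \<in> carrier_mat (block_offset q k) (block_offset q k)"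
    and 2: "B k \<in> carrier_mat (q k) (q k)" using Suc.prems by (simp_all add: block_diag_carrier)
  have 3: "block_offset q i + a < block_offset q k + q k"
    "block_offset q j + b < block_offset q k + q k"
    using block_index_less[of i "Suc k" a q] block_index_less[of j "Suc k" b q] Suc.prems
    by simp_all
  have 4: "i < k \<Longrightarrow> block_offset q i + a < block_offset q k"
    "j < k \<Longrightarrow> block_offset q j + b < block_offset q k"
    using block_index_less Suc.prems by blast+
  have eq: "block_diag (Suc k) B = four_block_mat (block_diag k B)
     (0\<^sub>m (block_offset q k) (q k)) (0\<^sub>m (q k) (block_offset q k)) (B k)"
    by (rule block_diag_Suc) (use Suc.prems in auto)
  show ?case
    unfolding eq using carrier_matD[OF 1] carrier_matD[OF 2] 3 4 Suc
    by (cases "i = k"; cases "j = k") auto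
qed simp

lemma block_mat_eqI:
  assumes "X \<in> carrier_mat n (block_offset q k)" "Y \<in> carrier_mat n (block_offset q k)"
    and "\<And>x i a. x < n \<Longrightarrow> i < k \<Longrightarrow> a < q i \<Longrightarrow>
      X $$ (x, block_offset q i + a) = Y $$ (x, block_offset q i + a)"
  shows "X = Y"
proof (rule eq_matI)
  fix x c assume "x < dim_row Y" "c < dim_col Y"
  then have x: "x < n" and c: "c < block_offset q k" using assms by auto
  from c obtain i a where "i < k" "a < q i" "c = block_offset q i + a"
    by (rule block_indexE)
  then show "X $$ (x, c) = Y $$ (x, c)" using assms(3) x by simp
qed (use assms in auto)

lemma block_mat_eqI2:
  assumes "X \<in> carrier_mat (block_offset q k) (block_offset q k)"
    and "Y \<in> carrier_mat (block_offset q k) (block_offset q k)"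
    and "\<And>i a j b. i < k \<Longrightarrow> a < q i \<Longrightarrow> j < k \<Longrightarrow> b < q j \<Longrightarrow>
      X $$ (block_offset q i + a, block_offset q j + b) =
      Y $$ (block_offset q i + a, block_offset q j + b)"
  shows "X = Y"
  using assms(1,2)
proof (rule block_mat_eqI)
  fix x j b assume x: "x < block_offset q k" and j: "j < k" "b < q j"
  from x obtain i a where "i < k" "a < q i" "x = block_offset q i + a"
    by (rule block_indexE)
  then show "X $$ (x, block_offset q j + b) = Y $$ (x, block_offset q j + b)"
    using assms(3) j by simp
qed

text \<open>In the sum over the inner index only block \<open>i\<close> contributes, since column
  \<open>block_offset q i + a\<close> of the block diagonal factor vanishes in all other
  blocks.\<close>

lemma hcat_mult_block_diag:
  assumes "\<And>i. i < k \<Longrightarrow> B i \<in> carrier_mat n (q i)"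
    and "\<And>i. i < k \<Longrightarrow> C i \<in> carrier_mat (q i) (q i)"
  shows "hcat n k B * block_diag k C = hcat n k (\<lambda>i. B i * C i)"
proof (rule block_mat_eqI[of _ n q k])
  show "hcat n k B * block_diag k C \<in> carrier_mat n (block_offset q k)"
    using assms by (metis hcat_carrier block_diag_carrier mult_carrier_mat)
  have BC: "B i * C i \<in> carrier_mat n (q i)" if "i < k" for i
    using assms that by (metis mult_carrier_mat)
  then show "hcat n k (\<lambda>i. B i * C i) \<in> carrier_mat n (block_offset q k)"
    by (rule hcat_carrier)
  fix x i a assume *: "x < n" "i < k" "a < q i"
  have "(hcat n k B * block_diag k C) $$ (x, block_offset q i + a) =
    (\<Sum>c<block_offset q k. hcat n k B $$ (x, c) * block_diag k C $$ (c, block_offset q i + a))"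
    using * by (intro mat_mult_index[of _ n _ _ "block_offset q k"] block_index_less
        hcat_carrier block_diag_carrier assms)
  also have "\<dots> = (\<Sum>j<k. \<Sum>b<q j. if j = i then B i $$ (x, b) * C i $$ (b, a) else 0)"
    unfolding sum_block_index using *
    by (intro sum.cong refl) (auto simp: hcat_index[of k B n q, OF assms(1)] block_diag_index[of k C q, OF assms(2)])
  also have "\<dots> = (\<Sum>j<k. if j = i then \<Sum>b<q j. B i $$ (x, b) * C i $$ (b, a) else 0)"
    by (intro sum.cong) auto
  also have "\<dots> = (\<Sum>b<q i. B i $$ (x, b) * C i $$ (b, a))"
    using * by (simp add: sum.delta)
  also have "\<dots> = (B i * C i) $$ (x, a)"
    by (rule mat_mult_index[OF assms(1)[OF *(2)] assms(2)[OF *(2)] *(1,3), symmetric])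
  also have "\<dots> = hcat n k (\<lambda>i. B i * C i) $$ (x, block_offset q i + a)"
    using * BC by (intro hcat_index[symmetric])
  finally show "(hcat n k B * block_diag k C) $$ (x, block_offset q i + a) =
    hcat n k (\<lambda>i. B i * C i) $$ (x, block_offset q i + a)" .
qed

lemma mult_hcat:
  assumes A: "A \<in> carrier_mat m n" and B: "\<And>i. i < k \<Longrightarrow> B i \<in> carrier_mat n (q i)"
  shows "A * hcat n k B = hcat m k (\<lambda>i. A * B i)"
proof (rule block_mat_eqI[of _ m q k])
  have AB: "A * B i \<in> carrier_mat m (q i)" if "i < k" for i
    using assms that by (metis mult_carrier_mat)
  show "A * hcat n k B \<in> carrier_mat m (block_offset q k)"
    using assms by (metis hcat_carrier mult_carrier_mat)
  show "hcat m k (\<lambda>i. A * B i) \<in> carrier_mat m (block_offset q k)"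
    using AB by (rule hcat_carrier)
  fix x i a assume *: "x < m" "i < k" "a < q i"
  have "(A * hcat n k B) $$ (x, block_offset q i + a) =
     (\<Sum>c<n. A $$ (x, c) * hcat n k B $$ (c, block_offset q i + a))"
    using * by (intro mat_mult_index[of _ m _ _ "block_offset q k"] block_index_less hcat_carrier assms)
  also have "\<dots> = (\<Sum>c<n. A $$ (x, c) * B i $$ (c, a))"
    using B * by (intro sum.cong refl) (simp add: hcat_index[of k B n q])
  also have "\<dots> = (A * B i) $$ (x, a)"
    by (rule mat_mult_index[OF A B[OF *(2)] *(1,3), symmetric])
  also have "\<dots> = hcat m k (\<lambda>i. A * B i) $$ (x, block_offset q i + a)"
    using * AB by (intro hcat_index[symmetric])
  finally show "(A * hcat n k B) $$ (x, block_offset q i + a) =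
    hcat m k (\<lambda>i. A * B i) $$ (x, block_offset q i + a)" .
qed

lemma gram_hcat_index:
  assumes "\<And>i. i < k \<Longrightarrow> B i \<in> carrier_mat n (q i)"
    and "i < k" "a < q i" "j < k" "b < q j"
  shows "(mat_adjoint (hcat n k B) * hcat n k B) $$ (block_offset q i + a, block_offset q j + b) =
    (mat_adjoint (B i) * B j) $$ (a, b)"
proof -
  have c: "hcat n k B \<in> carrier_mat n (block_offset q k)" using assms(1) by (rule hcat_carrier)
  have ia: "block_offset q i + a < block_offset q k" and jb: "block_offset q j + b < block_offset q k"
    using assms by (auto intro: block_index_less)
  have "(mat_adjoint (hcat n k B) * hcat n k B) $$ (block_offset q i + a, block_offset q j + b) =
    (\<Sum>x<n. mat_adjoint (hcat n k B) $$ (block_offset q i + a, x) * hcat n k B $$ (x, block_offset q j + b))"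
    using ia jb c by (intro mat_mult_index[where l = "block_offset q k"] mat_adjoint_carrier)
  also have "\<dots> = (\<Sum>x<n. mat_adjoint (B i) $$ (a, x) * B j $$ (x, b))"
    using assms(2-) ia carrier_matD[OF c] carrier_matD[OF assms(1)[OF assms(2)]]
    by (intro sum.cong refl) (simp add: hcat_index[of k B n q, OF assms(1)])
  also have "\<dots> = (mat_adjoint (B i) * B j) $$ (a, b)"
    by (rule mat_mult_index[OF mat_adjoint_carrier[OF assms(1)[OF assms(2)]] assms(1)[OF assms(4)]
        assms(3,5), symmetric])
  finally show ?thesis .
qed

text \<open>Mutual orthogonality of the blocks kills the off-diagonal blocks of the Gram matrix.
  This yields both the blockwise form of the cubic term and the orthonormality of the concatenated
  U.\<close>

lemma gram_hcat:
  assumes B: "\<And>i. i < k \<Longrightarrow> B i \<in> carrier_mat n (q i)"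
    and orth: "\<And>i j. i < k \<Longrightarrow> j < k \<Longrightarrow> i \<noteq> j \<Longrightarrow> mat_adjoint (B i) * B j = 0\<^sub>m (q i) (q j)"
  shows "mat_adjoint (hcat n k B) * hcat n k B = block_diag k (\<lambda>i. mat_adjoint (B i) * B i)"
proof (rule block_mat_eqI2[of _ q k])
  have c: "mat_adjoint (B i) * B i \<in> carrier_mat (q i) (q i)" if "i < k" for i
    using B that by (metis mat_adjoint_carrier mult_carrier_mat)
  then show "block_diag k (\<lambda>i. mat_adjoint (B i) * B i) \<in> carrier_mat (block_offset q k) (block_offset q k)"
    by (rule block_diag_carrier)
  have "hcat n k B \<in> carrier_mat n (block_offset q k)" using B by (rule hcat_carrier)
  then show "mat_adjoint (hcat n k B) * hcat n k B \<in> carrier_mat (block_offset q k) (block_offset q k)"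
    by (metis mat_adjoint_carrier mult_carrier_mat)
  fix i a j b assume *: "i < k" "a < q i" "j < k" "b < q j"
  then show "(mat_adjoint (hcat n k B) * hcat n k B) $$ (block_offset q i + a, block_offset q j + b) =
    block_diag k (\<lambda>i. mat_adjoint (B i) * B i) $$ (block_offset q i + a, block_offset q j + b)"
    using gram_hcat_index[of k B n q, OF B *] block_diag_index[of k "\<lambda>i. mat_adjoint (B i) * B i" q, OF c *]
      orth[of i j]
    by auto
qed

lemma block_diag_one:
  "block_diag k (\<lambda>i. 1\<^sub>m (q i)) = (1\<^sub>m (block_offset q k) :: 'a :: {zero, one} mat)"
  by (rule block_mat_eqI2[of _ q k])
    (auto simp: block_diag_index[of k _ q] block_index_less block_index_inj intro: block_diag_carrier)

lemma block_diag_cong: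
  "(\<And>i. i < k \<Longrightarrow> B i = C i) \<Longrightarrow> block_diag k B = block_diag k C"
  unfolding block_diag_def by (metis (no_types, lifting) atLeastLessThan_iff map_cong set_upt)

lemma hcat_cong:
  "(\<And>i. i < k \<Longrightarrow> B i = C i) \<Longrightarrow> hcat n k B = hcat n k C"
  unfolding hcat_def by (intro arg_cong[where f = "\<lambda>xs. mat_of_cols n (concat xs)"]) auto

lemma block_diag_mult:
  fixes B C :: "nat \<Rightarrow> 'a :: semiring_0 mat"
  assumes B: "\<And>i. i < k \<Longrightarrow> B i \<in> carrier_mat (q i) (q i)"
    and C: "\<And>i. i < k \<Longrightarrow> C i \<in> carrier_mat (q i) (q i)"
  shows "block_diag k B * block_diag k C = block_diag k (\<lambda>i. B i * C i)"
proof (rule block_mat_eqI2[of _ q k])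
  have BC: "B i * C i \<in> carrier_mat (q i) (q i)" if "i < k" for i
    using assms that by (metis mult_carrier_mat)
  then show "block_diag k (\<lambda>i. B i * C i) \<in> carrier_mat (block_offset q k) (block_offset q k)"
    by (rule block_diag_carrier)
  show "block_diag k B * block_diag k C \<in> carrier_mat (block_offset q k) (block_offset q k)"
    using assms by (metis block_diag_carrier mult_carrier_mat)
  fix i a j b assume *: "i < k" "a < q i" "j < k" "b < q j"
  have "(block_diag k B * block_diag k C) $$ (block_offset q i + a, block_offset q j + b) =
    (\<Sum>c<block_offset q k. block_diag k B $$ (block_offset q i + a, c) * block_diag k C $$ (c, block_offset q j + b))"
    using * by (intro mat_mult_index[of _ "block_offset q k" _ _ "block_offset q k"] block_index_less
        block_diag_carrier assms)
  also have "\<dots> = (\<Sum>l<k. \<Sum>c<q l. if l = i then (if i = j then B i $$ (a, c) * C i $$ (c, b) else 0) else 0)"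
    unfolding sum_block_index using *
    by (intro sum.cong refl) (auto simp: block_diag_index[of k B q, OF B] block_diag_index[of k C q, OF C])
  also have "\<dots> = (\<Sum>l<k. if l = i then \<Sum>c<q l. (if i = j then B i $$ (a, c) * C i $$ (c, b) else 0) else 0)"
    by (intro sum.cong) auto
  also have "\<dots> = (if i = j then \<Sum>c<q i. B i $$ (a, c) * C i $$ (c, b) else 0)"
    using * by (simp add: sum.delta)
  also have "\<dots> = (if i = j then (B i * C i) $$ (a, b) else 0)"
    using mat_mult_index[OF B[OF *(1)] C[OF *(1)], of a b] * by auto
  also have "\<dots> = block_diag k (\<lambda>i. B i * C i) $$ (block_offset q i + a, block_offset q j + b)"
    using block_diag_index[of k "\<lambda>i. B i * C i" q, OF BC *] by simp
  finally show "(block_diag k B * block_diag k C) $$ (block_offset q i + a, block_offset q j + b) =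
    block_diag k (\<lambda>i. B i * C i) $$ (block_offset q i + a, block_offset q j + b)" .
qed

lemma block_diag_adjoint:
  fixes B :: "nat \<Rightarrow> complex mat"
  assumes B: "\<And>i. i < k \<Longrightarrow> B i \<in> carrier_mat (q i) (q i)"
  shows "mat_adjoint (block_diag k B) = block_diag k (\<lambda>i. mat_adjoint (B i))"
proof (rule block_mat_eqI2[of _ q k])
  have c: "block_diag k B \<in> carrier_mat (block_offset q k) (block_offset q k)"
    using B by (rule block_diag_carrier)
  then show "mat_adjoint (block_diag k B) \<in> carrier_mat (block_offset q k) (block_offset q k)"
    by simp
  show "block_diag k (\<lambda>i. mat_adjoint (B i)) \<in> carrier_mat (block_offset q k) (block_offset q k)"
    using B by (intro block_diag_carrier) simp
  fix i a j b assume *: "i < k" "a < q i" "j < k" "b < q j"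
  then show "mat_adjoint (block_diag k B) $$ (block_offset q i + a, block_offset q j + b) =
    block_diag k (\<lambda>i. mat_adjoint (B i)) $$ (block_offset q i + a, block_offset q j + b)"
    using carrier_matD[OF c] block_index_less[of i k a q] block_index_less[of j k b q]
      carrier_matD[OF B, of i] carrier_matD[OF B, of j]
    by (auto simp: block_diag_index[of k B q, OF B]
        block_diag_index[of k "\<lambda>i. mat_adjoint (B i)" q, OF mat_adjoint_carrier[OF B]])
qed

lemma block_diag_map_mat:
  fixes B :: "nat \<Rightarrow> real mat"
  assumes B: "\<And>i. i < k \<Longrightarrow> B i \<in> carrier_mat (q i) (q i)"
  shows "map_mat complex_of_real (block_diag k B) = block_diag k (\<lambda>i. map_mat complex_of_real (B i))"
proof (rule block_mat_eqI2[of _ q k])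
  have c: "block_diag k B \<in> carrier_mat (block_offset q k) (block_offset q k)"
    using B by (rule block_diag_carrier)
  then show "map_mat complex_of_real (block_diag k B) \<in> carrier_mat (block_offset q k) (block_offset q k)"
    by simp
  show "block_diag k (\<lambda>i. map_mat complex_of_real (B i)) \<in> carrier_mat (block_offset q k) (block_offset q k)"
    using B by (intro block_diag_carrier) simp
  fix i a j b assume *: "i < k" "a < q i" "j < k" "b < q j"
  then show "map_mat complex_of_real (block_diag k B) $$ (block_offset q i + a, block_offset q j + b) =
    block_diag k (\<lambda>i. map_mat complex_of_real (B i)) $$ (block_offset q i + a, block_offset q j + b)"
    using carrier_matD[OF c] block_index_less[of i k a q] block_index_less[of j k b q]
      carrier_matD[OF B, of i] carrier_matD[OF B, of j]
      block_diag_index[of k "\<lambda>i. map_mat complex_of_real (B i)" q] B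
    by (auto simp: block_diag_index[of k B q, OF B])
qed

section \<open>Spectral theory of Hermitian matrices\<close>

text \<open>With a Schur triangularisation \<open>A = P B Q\<close>, the diagonal entry of \<open>B\<close> at the last
  nonzero coordinate of \<open>Q x\<close> is subtracted from \<open>A\<close>; applied to \<open>x\<close>, this shortens \<open>Q x\<close>, so after finitely
  many steps an eigenvector appears, without leaving \<open>N\<close>.\<close>

lemma invariant_eigenvector:
  fixes A :: "complex mat"
  assumes A: "A \<in> carrier_mat n n" and N: "N \<subseteq> carrier_vec n"
    and inv: "\<And>x e. x \<in> N \<Longrightarrow> A *\<^sub>v x - e \<cdot>\<^sub>v x \<in> N"
    and x0: "x0 \<in> N" "x0 \<noteq> 0\<^sub>v n"
  shows "\<exists>x\<in>N. \<exists>e. x \<noteq> 0\<^sub>v n \<and> A *\<^sub>v x = e \<cdot>\<^sub>v x"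
proof -
  obtain es where "char_poly A = (\<Prod>a\<leftarrow>es. [:- a, 1:])"
    using char_poly_factorized[OF A] by blast
  moreover obtain B P Q where "schur_decomposition A es = (B, P, Q)"
    by (cases "schur_decomposition A es") auto
  ultimately have sim: "similar_mat_wit A B P Q" and ut: "upper_triangular B"
    using schur_decomposition[OF A] by blast+
  note w = similar_mat_witD2[OF A sim]
  \<comment> \<open>In the coordinates \<open>Q *\<^sub>v x\<close> the matrix acts as the upper
    triangular \<open>B\<close>.\<close>
  have QA: "Q * A = B * Q"
  proof -
    have "Q * A = Q * (P * (B * Q))"
      unfolding w(3) using assoc_mult_mat[OF w(6,5,7)] by simp
    also have "\<dots> = (Q * P) * (B * Q)"
      using w by (intro assoc_mult_mat[symmetric]) auto
    also have "\<dots> = B * Q"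
      unfolding w(2) using w by (intro left_mult_one_mat[of _ n n]) auto
    finally show ?thesis .
  qed
  have "\<exists>x\<in>N. \<exists>e. x \<noteq> 0\<^sub>v n \<and> A *\<^sub>v x = e \<cdot>\<^sub>v x"
    if "x \<in> N" "x \<noteq> 0\<^sub>v n" "\<forall>i<n. h \<le> i \<longrightarrow> (Q *\<^sub>v x) $ i = 0" for x h
    using that
  proof (induction h arbitrary: x)
    \<comment> \<open>All coordinates of \<open>Q *\<^sub>v x\<close> vanish, so \<open>x\<close> is
      zero because \<open>P\<close> inverts \<open>Q\<close>: a contradiction.\<close>
    case 0
    have x: "x \<in> carrier_vec n" using 0 N by auto
    have "Q *\<^sub>v x = 0\<^sub>v n"
      using 0 w(7) x by (intro eq_vecI) auto
    then have "P *\<^sub>v (Q *\<^sub>v x) = 0\<^sub>v n"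
      using w(6) by (intro eq_vecI) auto
    moreover have "P *\<^sub>v (Q *\<^sub>v x) = x"
      using assoc_mult_mat_vec[OF w(6,7) x] w(1) x by simp
    ultimately show ?case using 0 by simp
  next
    case (Suc h)
    show ?case
    proof (cases "h < n")
      case False
      then show ?thesis using Suc by auto
    next
      case True
      have x: "x \<in> carrier_vec n" using Suc N by auto
      define e where "e = B $$ (h, h)"
      define z where "z = Q *\<^sub>v x"
      define y where "y = A *\<^sub>v x - e \<cdot>\<^sub>v x"
      have z0: "z $ i = 0" if "h < i" "i < n" for i
        using Suc.prems that w(7) x by (auto simp: z_def)
      have zc: "z \<in> carrier_vec n" using w(7) x by (auto simp: z_def)
      have yN: "y \<in> N" unfolding y_def using inv Suc by blast
      have "Q *\<^sub>v y = (Q * A) *\<^sub>v x - e \<cdot>\<^sub>v z"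
        unfolding y_def z_def using A w(7) x
        by (simp add: mult_minus_distrib_mat_vec[of _ n n] mult_mat_vec[of _ n n])
      also have "(Q * A) *\<^sub>v x = B *\<^sub>v z"
        unfolding QA z_def using w x by (intro assoc_mult_mat_vec) auto
      finally have Qy: "Q *\<^sub>v y = B *\<^sub>v z - e \<cdot>\<^sub>v z" .
      have "(Q *\<^sub>v y) $ i = 0" if i: "i < n" "h \<le> i" for i
      proof -
        have "(B *\<^sub>v z) $ i = (\<Sum>j<n. B $$ (i, j) * z $ j)"
          using w(5) zc i by (auto simp: scalar_prod_def atLeast0LessThan intro!: sum.cong)
        \<comment> \<open>For \<open>i > h\<close> everything vanishes: entries of \<open>B\<close>
          left of the diagonal are zero, and the other columns meet zero coordinates of
          \<open>z\<close>. In row \<open>h\<close> only the diagonal entry survives, and it is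
          \<open>e\<close>.\<close>
        also have "\<dots> = (\<Sum>j<n. if j = h then e * z $ i else 0)"
        proof (intro sum.cong refl)
          fix j assume "j \<in> {..<n}"
          then show "B $$ (i, j) * z $ j = (if j = h then e * z $ i else 0)"
            using z0[of i] z0[of j] upper_triangularD[OF ut, of j i] i w(5)
            by (cases "i = h"; cases j h rule: linorder_cases) (auto simp: e_def)
        qed
        also have "\<dots> = e * z $ i" using True by simp
        finally show ?thesis unfolding Qy using zc w(5) i by simp
      qed
      moreover have "A *\<^sub>v x = y + e \<cdot>\<^sub>v x"
        using A x by (intro eq_vecI) (auto simp: y_def)
      then have "A *\<^sub>v x = e \<cdot>\<^sub>v x" if "y = 0\<^sub>v n"
        using x that by simp
      \<comment> \<open>Either \<open>y\<close> is zero, and then \<open>x\<close> itself is the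
        eigenvector, or the induction hypothesis applies to \<open>y\<close>.\<close>
      ultimately show ?thesis
        using Suc.IH[OF yN] Suc.prems by blast
    qed
  qed
  from this[OF x0, of n] show ?thesis by simp
qed

text \<open>A homogeneous system with fewer equations than unknowns. Zero rows make its coefficient
  matrix square; the last row is then zero, so the transpose annihilates the last unit vector, the
  determinant vanishes, and a nonzero solution exists.\<close>

lemma orthogonal_vector_exists:
  fixes u :: "'a \<Rightarrow> complex vec"
  assumes "finite T" "card T < n" and u: "\<And>c. c \<in> T \<Longrightarrow> u c \<in> carrier_vec n"
  shows "\<exists>x\<in>carrier_vec n. x \<noteq> 0\<^sub>v n \<and> (\<forall>c\<in>T. x \<bullet>c u c = 0)"
proof -
  obtain f where f: "bij_betw f {..<card T} T"
    using ex_bij_betw_nat_finite[OF \<open>finite T\<close>] by (auto simp: atLeast0LessThan)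
  define M where "M = mat n n (\<lambda>(i, j). if i < card T then cnj (u (f i) $ j) else 0)"
  have M: "M \<in> carrier_mat n n" by (simp add: M_def)
  have "M\<^sup>T *\<^sub>v unit_vec n (n - 1) = 0\<^sub>v n"
  proof (rule eq_vecI)
    fix i assume "i < dim_vec (0\<^sub>v n :: complex vec)"
    then have i: "i < n" by simp
    have "(M\<^sup>T *\<^sub>v unit_vec n (n - 1)) $ i = row M\<^sup>T i $ (n - 1)"
      using M i by simp
    also have "\<dots> = 0" using i assms(2) by (simp add: M_def)
    finally show "(M\<^sup>T *\<^sub>v unit_vec n (n - 1)) $ i = 0\<^sub>v n $ i" using i by simp
  qed (use M in auto)
  moreover have "unit_vec n (n - 1) \<noteq> (0\<^sub>v n :: complex vec)"
    using assms(2) by (intro unit_vec_nonzero) simp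
  ultimately have "\<exists>v. v \<in> carrier_vec n \<and> v \<noteq> 0\<^sub>v n \<and> M\<^sup>T *\<^sub>v v = 0\<^sub>v n"
    using unit_vec_carrier[of n "n - 1"] by metis
  then have "det M\<^sup>T = 0"
    using det_0_iff_vec_prod_zero[OF transpose_carrier_mat[THEN iffD2, OF M]] by simp
  then have "det M = 0" using det_transpose[OF M] by simp
  then obtain x where x: "x \<in> carrier_vec n" "x \<noteq> 0\<^sub>v n" "M *\<^sub>v x = 0\<^sub>v n"
    using det_0_iff_vec_prod_zero[OF M] by blast
  have "x \<bullet>c u c = 0" if c: "c \<in> T" for c
  proof -
    obtain i where i: "i < card T" "c = f i"
      using f c by (auto simp: bij_betw_def)
    have "x \<bullet>c u c = (M *\<^sub>v x) $ i"
      using i assms(2) u[OF c] x(1)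
      by (auto simp: M_def scalar_prod_def mult.commute intro!: sum.cong)
    then show ?thesis using x(3) i assms(2) by simp
  qed
  with x show ?thesis by blast
qed

section \<open>Hermitian forms and real eigenvalues\<close>

lemma hermitian_scalar_prod:
  assumes A: "A \<in> carrier_mat n n" and h: "hermitian A"
    and x: "x \<in> carrier_vec n" and y: "y \<in> carrier_vec n"
  shows "(A *\<^sub>v x) \<bullet>c y = x \<bullet>c (A *\<^sub>v y)"
proof -
  have sym: "A $$ (i, j) = cnj (A $$ (j, i))" if "i < n" "j < n" for i j
  proof -
    have "A $$ (i, j) = mat_adjoint A $$ (i, j)" using h by (simp add: hermitian_def)
    then show ?thesis using A that by simp
  qed
  have "(A *\<^sub>v x) \<bullet>c y = (\<Sum>i<n. \<Sum>j<n. A $$ (i, j) * x $ j * cnj (y $ i))"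
    using A x y by (auto simp: scalar_prod_def atLeast0LessThan sum_distrib_right intro!: sum.cong)
  also have "\<dots> = (\<Sum>j<n. \<Sum>i<n. A $$ (i, j) * x $ j * cnj (y $ i))"
    by (rule sum.swap)
  also have "\<dots> = (\<Sum>j<n. \<Sum>i<n. x $ j * cnj (A $$ (j, i) * y $ i))"
  proof (intro sum.cong refl)
    fix j i assume "j \<in> {..<n}" "i \<in> {..<n}"
    then show "A $$ (i, j) * x $ j * cnj (y $ i) = x $ j * cnj (A $$ (j, i) * y $ i)"
      using sym[of i j] by (simp add: mult_ac)
  qed
  also have "\<dots> = x \<bullet>c (A *\<^sub>v y)"
    using A x y by (auto simp: scalar_prod_def atLeast0LessThan sum_distrib_left intro!: sum.cong)
  finally show ?thesis .
qed

lemma cscalar_prod_swap: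
  fixes x y :: "complex vec"
  assumes "x \<in> carrier_vec n" "y \<in> carrier_vec n"
  shows "y \<bullet>c x = cnj (x \<bullet>c y)"
  using assms by (auto simp: scalar_prod_def mult.commute intro!: sum.cong)

lemma cscalar_prod_self:
  fixes x :: "complex vec"
  assumes "x \<in> carrier_vec n"
  shows "x \<bullet>c x = complex_of_real (\<Sum>i<n. (cmod (x $ i))\<^sup>2)"
  using assms by (auto simp: scalar_prod_def atLeast0LessThan complex_norm_square[symmetric] intro!: sum.cong)

lemma hermitian_eigenvalue_real:
  assumes A: "A \<in> carrier_mat n n" and h: "hermitian A"
    and x: "x \<in> carrier_vec n" "x \<noteq> 0\<^sub>v n" and ev: "A *\<^sub>v x = e \<cdot>\<^sub>v x"
  shows "e = complex_of_real (Re e)"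
proof -
  have "e * (x \<bullet>c x) = cnj e * (x \<bullet>c x)"
    using hermitian_scalar_prod[OF A h x(1) x(1)] x(1) unfolding ev
    by (simp add: conjugate_smult_vec)
  moreover have "x \<bullet>c x \<noteq> 0"
    using conjugate_square_eq_0_vec[OF x(1)] x(2) by simp
  ultimately have "cnj e = e" by simp
  then show ?thesis by (simp add: complex_eq_iff)
qed

section \<open>Orthonormal systems of eigenvectors\<close>

text \<open>The index type is arbitrary because the indices are column numbers in the spectral
  theorem and pairs of a block and a column in the completion of the U_i.\<close>

definition orthonormal_eigenvectors ::
  "complex mat \<Rightarrow> nat \<Rightarrow> 'a set \<Rightarrow> ('a \<Rightarrow> complex vec) \<Rightarrow> ('a \<Rightarrow> real) \<Rightarrow> bool" where
  "orthonormal_eigenvectors A n T u lam \<longleftrightarrow>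
     (\<forall>c\<in>T. u c \<in> carrier_vec n \<and> A *\<^sub>v u c = complex_of_real (lam c) \<cdot>\<^sub>v u c) \<and>
     (\<forall>c\<in>T. \<forall>d\<in>T. u c \<bullet>c u d = (if c = d then 1 else 0))"

text \<open>The orthogonal complement of the \<open>u c\<close> is nonzero by counting. It is
  invariant under \<open>A\<close>, since A can be moved to \<open>u c\<close>, where it acts as a
  scalar. It therefore contains an eigenvector, whose eigenvalue is real and which can be
  normalised.\<close>

lemma orthonormal_eigenvectors_step:
  assumes A: "A \<in> carrier_mat n n" and h: "hermitian A"
    and T: "finite T" "card T < n" and u: "orthonormal_eigenvectors A n T u lam"
  shows "\<exists>x l. x \<in> carrier_vec n \<and> A *\<^sub>v x = complex_of_real l \<cdot>\<^sub>v x \<and> x \<bullet>c x = 1 \<and>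
    (\<forall>c\<in>T. x \<bullet>c u c = 0 \<and> u c \<bullet>c x = 0)"
proof -
  define N where "N = {x \<in> carrier_vec n. \<forall>c\<in>T. x \<bullet>c u c = 0}"
  have uc: "u c \<in> carrier_vec n" and Au: "A *\<^sub>v u c = complex_of_real (lam c) \<cdot>\<^sub>v u c" if "c \<in> T" for c
    using u that by (auto simp: orthonormal_eigenvectors_def)
  obtain x0 where "x0 \<in> N" "x0 \<noteq> 0\<^sub>v n"
    using orthogonal_vector_exists[OF T, of u] uc by (auto simp: N_def)
  moreover have "A *\<^sub>v x - e \<cdot>\<^sub>v x \<in> N" if x: "x \<in> N" for x e
  proof -
    have xc: "x \<in> carrier_vec n" and x0: "\<And>c. c \<in> T \<Longrightarrow> x \<bullet>c u c = 0"
      using x by (auto simp: N_def)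
    have "(A *\<^sub>v x - e \<cdot>\<^sub>v x) \<bullet>c u c = 0" if c: "c \<in> T" for c
    proof -
      have "(A *\<^sub>v x - e \<cdot>\<^sub>v x) \<bullet>c u c = (A *\<^sub>v x) \<bullet>c u c - (e \<cdot>\<^sub>v x) \<bullet>c u c"
        using A xc uc[OF c] by (intro minus_scalar_prod_distrib[of _ n]) auto
      also have "(A *\<^sub>v x) \<bullet>c u c = 0"
        using hermitian_scalar_prod[OF A h xc uc[OF c]] x0[OF c] xc uc[OF c]
        unfolding Au[OF c] by (simp add: conjugate_smult_vec)
      also have "(e \<cdot>\<^sub>v x) \<bullet>c u c = 0"
        using x0[OF c] xc uc[OF c] by simp
      finally show ?thesis by simp
    qed
    then show ?thesis using A xc by (auto simp: N_def)
  qed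
  ultimately obtain y e where y: "y \<in> N" "y \<noteq> 0\<^sub>v n" "A *\<^sub>v y = e \<cdot>\<^sub>v y"
    using invariant_eigenvector[OF A, of N x0] by (auto simp: N_def)
  have yc: "y \<in> carrier_vec n" and y0: "\<And>c. c \<in> T \<Longrightarrow> y \<bullet>c u c = 0"
    using y by (auto simp: N_def)
  have e: "e = complex_of_real (Re e)"
    by (rule hermitian_eigenvalue_real[OF A h yc y(2,3)])
  define s where "s = (\<Sum>i<n. (cmod (y $ i))\<^sup>2)"
  have ys: "y \<bullet>c y = complex_of_real s"
    unfolding s_def by (rule cscalar_prod_self[OF yc])
  have "s \<noteq> 0"
    using conjugate_square_eq_0_vec[OF yc] y(2) ys by auto
  moreover have "s \<ge> 0" unfolding s_def by (intro sum_nonneg) auto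
  ultimately have s: "s > 0" by simp
  define t where "t = 1 / sqrt s"
  define x where "x = complex_of_real t \<cdot>\<^sub>v y"
  have xc: "x \<in> carrier_vec n" using yc by (simp add: x_def)
  have "x \<bullet>c x = complex_of_real (t * t * s)"
    using yc ys by (simp add: x_def conjugate_smult_vec)
  also have "t * t * s = 1"
    using s by (simp add: t_def field_simps)
  finally have xx: "x \<bullet>c x = 1" by simp
  have Ay: "A *\<^sub>v y = complex_of_real (Re e) \<cdot>\<^sub>v y"
    by (subst e[symmetric]) (rule y(3))
  have Ax: "A *\<^sub>v x = complex_of_real (Re e) \<cdot>\<^sub>v x"
    using A yc Ay by (simp add: x_def mult_mat_vec[of _ n n] smult_smult_assoc mult.commute)
  have x1: "x \<bullet>c u c = 0" if "c \<in> T" for c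
    using y0[OF that] yc uc[OF that] by (simp add: x_def)
  then have "u c \<bullet>c x = 0" if "c \<in> T" for c
    using cscalar_prod_swap[OF xc uc[OF that]] that by simp
  with x1 xc xx Ax show ?thesis by blast
qed

text \<open>Vectors are added one at a time. The old ones are kept unchanged, because they will be
  the normalised columns of the X_i V_i and their eigenvalues enter the formula for the singular
  values.\<close>

lemma orthonormal_eigenvectors_extend:
  assumes A: "A \<in> carrier_mat n n" and h: "hermitian A"
    and "finite T" "T \<subseteq> T'" "finite T'" "card T' \<le> n"
    and u: "orthonormal_eigenvectors A n T u lam"
  shows "\<exists>u' lam'. orthonormal_eigenvectors A n T' u' lam' \<and> (\<forall>c\<in>T. u' c = u c \<and> lam' c = lam c)"
proof -
  have "\<exists>u' lam'. orthonormal_eigenvectors A n (T \<union> D) u' lam' \<and> (\<forall>c\<in>T. u' c = u c \<and> lam' c = lam c)"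
    if "finite D" "T \<inter> D = {}" "card (T \<union> D) \<le> n" for D
    using that
  proof (induction D rule: finite_induct)
    case empty
    then show ?case using u by auto
  next
    case (insert d D)
    have fin: "finite (T \<union> D)" using insert \<open>finite T\<close> by auto
    have "T \<union> insert d D = insert d (T \<union> D)" "d \<notin> T \<union> D" using insert by auto
    then have c: "card (T \<union> D) < n" using insert.prems fin by simp
    with insert obtain v m where v: "orthonormal_eigenvectors A n (T \<union> D) v m"
      and vT: "\<forall>c\<in>T. v c = u c \<and> m c = lam c" by auto
    obtain x l where "x \<in> carrier_vec n" "A *\<^sub>v x = complex_of_real l \<cdot>\<^sub>v x" "x \<bullet>c x = 1"
      "\<forall>c\<in>T \<union> D. x \<bullet>c v c = 0 \<and> v c \<bullet>c x = 0"
      using orthonormal_eigenvectors_step[OF A h fin c v] by blast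
    with v insert(2,4) have "orthonormal_eigenvectors A n (T \<union> insert d D) (v(d := x)) (m(d := l))"
      unfolding orthonormal_eigenvectors_def by auto
    moreover have "\<forall>c\<in>T. (v(d := x)) c = u c \<and> (m(d := l)) c = lam c"
      using vT insert.prems by auto
    ultimately show ?case by blast
  qed
  from this[of "T' - T"] assms(3-6) show ?thesis
    by (simp add: Un_absorb1)
qed

text \<open>Extending the empty system to \<open>n\<close> vectors yields an orthonormal eigenbasis,
  which becomes the columns of \<open>V\<close>.\<close>

lemma hermitian_spectral:
  assumes A: "A \<in> carrier_mat n n" and h: "hermitian A"
  shows "\<exists>V g. is_unitary n V \<and> A * V = V * mat_diag n (\<lambda>j. complex_of_real (g j))"
proof -
  have "orthonormal_eigenvectors A n {} (\<lambda>_ :: nat. 0\<^sub>v n) (\<lambda>_. 0)"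
    by (simp add: orthonormal_eigenvectors_def)
  then obtain u g where ug: "orthonormal_eigenvectors A n {..<n} u g"
    using orthonormal_eigenvectors_extend[OF A h, of "{}" "{..<n}"] by fastforce
  define V where "V = mat n n (\<lambda>(i, j). u j $ i)"
  have V: "V \<in> carrier_mat n n" by (simp add: V_def)
  have uc: "u j \<in> carrier_vec n" and Au: "A *\<^sub>v u j = complex_of_real (g j) \<cdot>\<^sub>v u j" if "j < n" for j
    using ug that by (auto simp: orthonormal_eigenvectors_def)
  have colV: "col V j = u j" if "j < n" for j
    using carrier_vecD[OF uc[OF that]] that by (intro eq_vecI) (auto simp: V_def)
  have "mat_adjoint V * V = 1\<^sub>m n"
  proof (rule eq_matI)
    fix i j assume "i < dim_row (1\<^sub>m n :: complex mat)" "j < dim_col (1\<^sub>m n :: complex mat)"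
    then show "(mat_adjoint V * V) $$ (i, j) = 1\<^sub>m n $$ (i, j)"
      using gram_index[OF V V, of i j] ug by (auto simp: colV orthonormal_eigenvectors_def)
  qed (use V in auto)
  moreover from this have "V * mat_adjoint V = 1\<^sub>m n"
    using mat_mult_left_right_inverse[of "mat_adjoint V" n V] V by simp
  moreover have "A * V = V * mat_diag n (\<lambda>j. complex_of_real (g j))"
    unfolding mat_diag_mult_right[OF V]
  proof (rule eq_matI)
    fix i j
    assume "i < dim_row (mat n n (\<lambda>(i, j). V $$ (i, j) * complex_of_real (g j)))"
      "j < dim_col (mat n n (\<lambda>(i, j). V $$ (i, j) * complex_of_real (g j)))"
    then have ij: "i < n" "j < n" by auto
    have "(A * V) $$ (i, j) = (A *\<^sub>v col V j) $ i"
      using A V ij by simp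
    also have "\<dots> = V $$ (i, j) * complex_of_real (g j)"
      using ij V unfolding colV[OF ij(2)] Au[OF ij(2)] unfolding colV[OF ij(2), symmetric] by simp
    finally show "(A * V) $$ (i, j) = mat n n (\<lambda>(i, j). V $$ (i, j) * complex_of_real (g j)) $$ (i, j)"
      using ij by simp
  qed (use A V in auto)
  ultimately show ?thesis using V unfolding is_unitary_def by blast
qed

section \<open>Singular values and rank\<close>

lemma gram_diag_index:
  fixes A :: "complex mat"
  assumes "A \<in> carrier_mat n m" "j < m"
  shows "(mat_adjoint A * A) $$ (j, j) = complex_of_real (\<Sum>i<n. (cmod (A $$ (i, j)))\<^sup>2)"
  using gram_index[OF assms(1,1) assms(2,2)] cscalar_prod_self[of "col A j" n] assms by simp

section \<open>Permutation matrices and grouping of columns\<close>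

definition perm_mat :: "nat \<Rightarrow> (nat \<Rightarrow> nat) \<Rightarrow> complex mat" where
  "perm_mat p \<pi> = mat p p (\<lambda>(i, j). if i = \<pi> j then 1 else 0)"

lemma perm_mat_carrier [simp]: "perm_mat p \<pi> \<in> carrier_mat p p"
  by (simp add: perm_mat_def)

lemma mult_perm_mat:
  assumes "X \<in> carrier_mat n p" "\<pi> permutes {..<p}"
  shows "X * perm_mat p \<pi> = mat n p (\<lambda>(x, j). X $$ (x, \<pi> j))"
proof (rule eq_matI)
  fix x j
  assume "x < dim_row (mat n p (\<lambda>(x, j). X $$ (x, \<pi> j)))" "j < dim_col (mat n p (\<lambda>(x, j). X $$ (x, \<pi> j)))"
  then have xj: "x < n" "j < p" by auto
  then have pj: "\<pi> j < p" using permutes_in_image[OF assms(2), of j] by auto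
  have "(X * perm_mat p \<pi>) $$ (x, j) = (\<Sum>c<p. X $$ (x, c) * perm_mat p \<pi> $$ (c, j))"
    by (rule mat_mult_index[OF assms(1) perm_mat_carrier xj])
  also have "\<dots> = (\<Sum>c<p. if c = \<pi> j then X $$ (x, c) else 0)"
    using xj by (intro sum.cong) (auto simp: perm_mat_def)
  also have "\<dots> = X $$ (x, \<pi> j)" using pj by simp
  finally show "(X * perm_mat p \<pi>) $$ (x, j) = mat n p (\<lambda>(x, j). X $$ (x, \<pi> j)) $$ (x, j)"
    using xj by simp
qed (use assms in \<open>auto simp: perm_mat_def\<close>)

lemma perm_mat_unitary:
  assumes "\<pi> permutes {..<p}"
  shows "is_unitary p (perm_mat p \<pi>)"
proof -
  have "mat_adjoint (perm_mat p \<pi>) * perm_mat p \<pi> = 1\<^sub>m p"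
    unfolding mult_perm_mat[OF mat_adjoint_carrier[OF perm_mat_carrier] assms]
  proof (rule eq_matI)
    fix i j assume ij: "i < dim_row (1\<^sub>m p :: complex mat)" "j < dim_col (1\<^sub>m p :: complex mat)"
    then have "\<pi> j < p" "\<pi> j = \<pi> i \<longleftrightarrow> i = j"
      using permutes_in_image[OF assms, of j] permutes_inj[OF assms] by (auto simp: inj_eq)
    then show "mat p p (\<lambda>(i, j). mat_adjoint (perm_mat p \<pi>) $$ (i, \<pi> j)) $$ (i, j) = 1\<^sub>m p $$ (i, j)"
      using ij by (simp add: perm_mat_def)
  qed auto
  moreover from this have "perm_mat p \<pi> * mat_adjoint (perm_mat p \<pi>) = 1\<^sub>m p"
    using mat_mult_left_right_inverse[of "mat_adjoint (perm_mat p \<pi>)" p "perm_mat p \<pi>"] by simp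
  ultimately show ?thesis by (simp add: is_unitary_def)
qed

text \<open>Permuting the columns of a diagonalising matrix permutes the eigenvalues in the same
  way; this is how eigenvalues get reordered.\<close>

lemma mat_diag_perm_mat:
  assumes "\<pi> permutes {..<p}"
  shows "mat_diag p d * perm_mat p \<pi> = perm_mat p \<pi> * mat_diag p (\<lambda>j. d (\<pi> j))"
  unfolding mult_perm_mat[OF mat_diag_dim assms] mat_diag_mult_right[OF perm_mat_carrier]
  using permutes_in_image[OF assms] by (intro eq_matI) (auto simp: mat_diag_def perm_mat_def)

lemma unitary_mult:
  assumes "is_unitary m V" "is_unitary m W"
  shows "is_unitary m (V * W)"
proof -
  have V: "V \<in> carrier_mat m m" "mat_adjoint V * V = 1\<^sub>m m" and W: "W \<in> carrier_mat m m" "mat_adjoint W * W = 1\<^sub>m m"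
    using assms by (auto simp: is_unitary_def)
  have VW: "V * W \<in> carrier_mat m m" using V W by auto
  have "mat_adjoint (V * W) * (V * W) = mat_adjoint W * (mat_adjoint V * (V * W))"
    unfolding mat_adjoint_mult[OF V(1) W(1)] using V W by (intro assoc_mult_mat) auto
  also have "mat_adjoint V * (V * W) = (mat_adjoint V * V) * W"
    using V W by (intro assoc_mult_mat[symmetric]) auto
  also have "\<dots> = W" unfolding V(2) using W by simp
  finally have "mat_adjoint (V * W) * (V * W) = 1\<^sub>m m" unfolding W(2) .
  moreover from this have "(V * W) * mat_adjoint (V * W) = 1\<^sub>m m"
    by (rule mat_mult_left_right_inverse[OF mat_adjoint_carrier[OF VW] VW])
  ultimately show ?thesis using VW by (simp add: is_unitary_def)
qed

text \<open>A counting sort: the positions of class 0, then those of class 1, and so on, are listed,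
  and \<rho> reads off this list. It serves to move zero singular values to the end and to collect
  columns with equal multipliers.\<close>

lemma grouping_permutation:
  fixes f :: "nat \<Rightarrow> nat"
  assumes f: "\<And>j. j < p \<Longrightarrow> f j < k" and q: "\<And>i. q i = card {j. j < p \<and> f j = i}"
  shows "block_offset q k = p"
    and "\<exists>\<rho>. \<rho> permutes {..<p} \<and> (\<forall>i<k. \<forall>a<q i. f (\<rho> (block_offset q i + a)) = i)"
proof -
  have "block_offset q k = (\<Sum>i\<in>{..<k}. card {j. j < p \<and> f j = i})"
    by (simp add: block_offset_def q)
  also have "\<dots> = card (\<Union>i<k. {j. j < p \<and> f j = i})"
    by (rule card_UN_disjoint[symmetric]) auto
  also have "(\<Union>i<k. {j. j < p \<and> f j = i}) = {..<p}" using f by auto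
  finally show p: "block_offset q k = p" by simp
  define L where "L i = filter (\<lambda>j. f j = i) [0..<p]" for i
  have lenL: "length (L i) = q i" for i
  proof -
    have "length (L i) = card (set (L i))" unfolding L_def by (rule distinct_card[symmetric]) simp
    also have "set (L i) = {j. j < p \<and> f j = i}" by (auto simp: L_def)
    finally show ?thesis by (simp add: q)
  qed
  define xs where "xs = concat (map L [0..<k])"
  have len: "length xs = p"
    using p by (simp add: xs_def length_concat lenL block_offset_def comp_def interv_sum_list_conv_sum_set_nat atLeast0LessThan)
  have set: "set xs = {..<p}" using f by (auto simp: xs_def L_def)
  \<comment> \<open>A list of length \<open>p\<close> with \<open>p\<close> different members cannot
    repeat any.\<close>
  have dist: "distinct xs" by (rule card_distinct) (simp add: len set)
  define \<rho> where "\<rho> j = (if j < p then xs ! j else j)" for j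
  have "bij_betw \<rho> {..<p} {..<p} \<longleftrightarrow> bij_betw ((!) xs) {..<p} {..<p}"
    by (rule bij_betw_cong) (simp add: \<rho>_def)
  moreover have "bij_betw ((!) xs) {..<p} {..<p}"
    by (rule bij_betw_nth[OF dist]) (simp_all add: len set)
  ultimately have "bij_betw \<rho> {..<p} {..<p}" by simp
  then have "\<rho> permutes {..<p}"
    by (rule bij_imp_permutes) (simp add: \<rho>_def)
  moreover have "f (\<rho> (block_offset q i + a)) = i" if "i < k" "a < q i" for i a
  proof -
    have "block_offset q i + a < p" using block_index_less[of i k a q] that p by simp
    then have "\<rho> (block_offset q i + a) = L i ! a"
      using concat_blocks_nth(2)[of k L q i a, OF lenL that] by (simp add: \<rho>_def xs_def)
    also have "L i ! a \<in> set (L i)" using that lenL by (intro nth_mem) simp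
    finally show ?thesis by (simp add: L_def)
  qed
  ultimately show "\<exists>\<rho>. \<rho> permutes {..<p} \<and> (\<forall>i<k. \<forall>a<q i. f (\<rho> (block_offset q i + a)) = i)"
    by blast
qed

section \<open>Singular values, trace and rank\<close>

text \<open>The spectral theorem for X^* X, with the positive eigenvalues moved to the front,
  because the block conditions put the zero singular values at the end.\<close>

lemma gram_diagonalization:
  fixes X :: "complex mat"
  assumes X: "X \<in> carrier_mat n m"
  obtains V r g where "is_unitary m V" "r \<le> m" "\<And>j. j < r \<Longrightarrow> 0 < g j"
    "\<And>j. r \<le> j \<Longrightarrow> j < m \<Longrightarrow> g j = 0"
    "mat_adjoint X * X * V = V * mat_diag m (\<lambda>j. complex_of_real (g j))"
    "mat_adjoint (X * V) * (X * V) = mat_diag m (\<lambda>j. complex_of_real (g j))"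
proof -
  define G where "G = mat_adjoint X * X"
  have G: "G \<in> carrier_mat m m" using X by (auto simp: G_def)
  have "mat_adjoint G = G"
    unfolding G_def mat_adjoint_mult[OF mat_adjoint_carrier[OF X] X] by simp
  then have "hermitian G" using G by (simp add: hermitian_def)
  then obtain V0 g0 where V0: "is_unitary m V0"
    and GV0: "G * V0 = V0 * mat_diag m (\<lambda>j. complex_of_real (g0 j))"
    using hermitian_spectral[OF G] by blast
  have V0c: "V0 \<in> carrier_mat m m" using V0 by (simp add: is_unitary_def)
  \<comment> \<open>Class 0 holds the nonzero eigenvalues, so these come first and their number
    \<open>q 0\<close> serves as \<open>r\<close>.\<close>
  define f :: "nat \<Rightarrow> nat" where "f j = (if g0 j = 0 then 1 else 0)" for j
  define q where "q i = card {j. j < m \<and> f j = i}" for i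
  have f: "f j < 2" for j by (simp add: f_def)
  have m: "block_offset q 2 = m"
    using f by (rule grouping_permutation(1)) (rule q_def)
  then have q1: "q 0 + q 1 = m"
    by (simp add: block_offset_def lessThan_Suc numeral_2_eq_2)
  from f obtain \<rho> where \<rho>: "\<rho> permutes {..<m}"
    and f\<rho>: "\<And>i a. i < 2 \<Longrightarrow> a < q i \<Longrightarrow> f (\<rho> (block_offset q i + a)) = i"
    using grouping_permutation(2)[of m f 2 q, OF _ q_def] by blast
  define V where "V = V0 * perm_mat m \<rho>"
  define g where "g j = g0 (\<rho> j)" for j
  have V: "is_unitary m V" unfolding V_def by (rule unitary_mult[OF V0 perm_mat_unitary[OF \<rho>]])
  then have Vc: "V \<in> carrier_mat m m" and VV: "mat_adjoint V * V = 1\<^sub>m m" by (auto simp: is_unitary_def)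
  let ?D = "mat_diag m (\<lambda>j. complex_of_real (g j))"
  have "G * V = (G * V0) * perm_mat m \<rho>"
    unfolding V_def by (rule assoc_mult_mat[OF G V0c perm_mat_carrier, symmetric])
  also have "\<dots> = V0 * (mat_diag m (\<lambda>j. complex_of_real (g0 j)) * perm_mat m \<rho>)"
    unfolding GV0 by (rule assoc_mult_mat[OF V0c mat_diag_dim perm_mat_carrier])
  also have "\<dots> = V0 * (perm_mat m \<rho> * ?D)"
    unfolding mat_diag_perm_mat[OF \<rho>] g_def ..
  also have "\<dots> = V * ?D"
    unfolding V_def by (rule assoc_mult_mat[OF V0c perm_mat_carrier mat_diag_dim, symmetric])
  finally have GV: "G * V = V * ?D" .
  have XV: "X * V \<in> carrier_mat n m" using X Vc by auto
  have "mat_adjoint (X * V) * (X * V) = mat_adjoint V * (mat_adjoint X * (X * V))"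
    unfolding mat_adjoint_mult[OF X Vc] using X Vc by (intro assoc_mult_mat) auto
  also have "mat_adjoint X * (X * V) = G * V"
    unfolding G_def using X Vc by (intro assoc_mult_mat[symmetric]) auto
  also have "mat_adjoint V * (G * V) = (mat_adjoint V * V) * ?D"
    unfolding GV by (rule assoc_mult_mat[OF mat_adjoint_carrier[OF Vc] Vc mat_diag_dim, symmetric])
  also have "\<dots> = ?D" unfolding VV by (rule left_mult_one_mat[OF mat_diag_dim])
  finally have gram: "mat_adjoint (X * V) * (X * V) = ?D" .
  \<comment> \<open>An eigenvalue of the Gram matrix is the squared length of a column of
    \<open>X * V\<close>.\<close>
  have nonneg: "g j \<ge> 0" if "j < m" for j
  proof -
    have "complex_of_real (g j) = (mat_adjoint (X * V) * (X * V)) $$ (j, j)"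
      unfolding gram using that by (simp add: mat_diag_def)
    also have "\<dots> = complex_of_real (\<Sum>i<n. (cmod ((X * V) $$ (i, j)))\<^sup>2)"
      by (rule gram_diag_index[OF XV that])
    finally have "g j = (\<Sum>i<n. (cmod ((X * V) $$ (i, j)))\<^sup>2)"
      using of_real_eq_iff by blast
    then show ?thesis by (simp add: sum_nonneg)
  qed
  have "0 < g j" if "j < q 0" for j
    using f\<rho>[of 0 j] that nonneg[of j] q1 by (auto simp: f_def g_def split: if_splits)
  moreover have "g j = 0" if "q 0 \<le> j" "j < m" for j
  proof -
    have "f (\<rho> (block_offset q 1 + (j - q 0))) = 1" using f\<rho>[of 1 "j - q 0"] that q1 by simp
    moreover have "block_offset q 1 + (j - q 0) = j" using that by (simp add: block_offset_def)
    ultimately show ?thesis by (simp add: f_def g_def split: if_splits)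
  qed
  ultimately show thesis
    using that[of V "q 0" g] V q1 GV gram unfolding G_def by simp
qed

text \<open>The trace is invariant under unitary conjugation, as G = V D V^*. It converts unit
  columns into a statement about the sum of the squared singular values.\<close>

lemma gram_trace:
  fixes G :: "complex mat"
  assumes G: "G \<in> carrier_mat m m" and V: "is_unitary m V"
    and GV: "G * V = V * mat_diag m d"
  shows "(\<Sum>a<m. G $$ (a, a)) = (\<Sum>j<m. d j)"
proof -
  have Vc: "V \<in> carrier_mat m m" and VV: "mat_adjoint V * V = 1\<^sub>m m" "V * mat_adjoint V = 1\<^sub>m m"
    using V by (auto simp: is_unitary_def)
  have "G = G * (V * mat_adjoint V)" unfolding VV using G by simp
  also have "\<dots> = (G * V) * mat_adjoint V"
    using G Vc by (intro assoc_mult_mat[symmetric]) auto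
  finally have "G = (V * mat_diag m d) * mat_adjoint V" unfolding GV .
  then have "G $$ (a, a) = (\<Sum>j<m. d j * (mat_adjoint V $$ (j, a) * V $$ (a, j)))" if "a < m" for a
    using mat_mult_index[of "V * mat_diag m d" m m "mat_adjoint V" m a a] that Vc
    unfolding mat_diag_mult_right[OF Vc] by (auto intro!: sum.cong)
  then have "(\<Sum>a<m. G $$ (a, a)) = (\<Sum>a<m. \<Sum>j<m. d j * (mat_adjoint V $$ (j, a) * V $$ (a, j)))"
    by (intro sum.cong) auto
  also have "\<dots> = (\<Sum>j<m. \<Sum>a<m. d j * (mat_adjoint V $$ (j, a) * V $$ (a, j)))"
    by (rule sum.swap)
  also have "\<dots> = (\<Sum>j<m. d j * (mat_adjoint V * V) $$ (j, j))"
    using Vc by (intro sum.cong refl, subst mat_mult_index[of _ m m]) (auto simp: sum_distrib_left)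
  also have "\<dots> = (\<Sum>j<m. d j)" unfolding VV by (intro sum.cong) auto
  finally show ?thesis .
qed

text \<open>X has the same column space as the first \<open>r\<close> columns of U, and these are
  orthonormal, hence independent.\<close>

lemma rank_reduced_svd:
  fixes U V :: "complex mat"
  assumes U: "U \<in> carrier_mat n m" "mat_adjoint U * U = 1\<^sub>m m" and V: "is_unitary m V"
    and X: "X = U * mat_diag m s * mat_adjoint V"
    and r: "r \<le> m" "\<And>j. j < m \<Longrightarrow> s j \<noteq> 0 \<longleftrightarrow> j < r"
  shows "vec_space.rank n X = r"
proof -
  interpret vec_space "TYPE(complex)" n .
  have Vc: "V \<in> carrier_mat m m" and VV: "mat_adjoint V * V = 1\<^sub>m m"
    using V by (auto simp: is_unitary_def)
  have Xc: "X \<in> carrier_mat n m" using U Vc unfolding X by auto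
  have UD: "U * mat_diag m s \<in> carrier_mat n m"
    by (rule mult_carrier_mat[OF U(1) mat_diag_dim])
  \<comment> \<open>\<open>W\<close> consists of the columns of U with nonzero scaling factor.
    \<open>C\<close> expresses X through them, and \<open>D\<close> undoes this by multiplying with
    V and dividing by the nonzero factors; the two factorisations give the two inclusions of column
    spaces.\<close>
  define W where "W = mat n r (\<lambda>(i, j). U $$ (i, j))"
  define C where "C = mat r m (\<lambda>(j, b). s j * mat_adjoint V $$ (j, b))"
  define D where "D = mat m r (\<lambda>(b, j). V $$ (b, j) / s j)"
  have W: "W \<in> carrier_mat n r" and C: "C \<in> carrier_mat r m" and D: "D \<in> carrier_mat m r"
    by (simp_all add: W_def C_def D_def)
  have s0: "s j = 0" if "r \<le> j" "j < m" for j
    using r(2)[OF that(2)] that(1) by (meson not_less)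
  have XWC: "X = W * C"
  proof (rule eq_matI)
    fix i b assume "i < dim_row (W * C)" "b < dim_col (W * C)"
    then have ib: "i < n" "b < m" using W C by auto
    have "X $$ (i, b) = (\<Sum>j<m. U $$ (i, j) * s j * mat_adjoint V $$ (j, b))"
      unfolding X mat_diag_mult_right[OF U(1)] using ib Vc
      by (subst mat_mult_index[of _ n m _ m]) (auto intro!: sum.cong)
    also have "\<dots> = (\<Sum>j<r. U $$ (i, j) * s j * mat_adjoint V $$ (j, b))"
      using r(1) s0 by (intro sum.mono_neutral_right) auto
    also have "\<dots> = (W * C) $$ (i, b)"
      unfolding mat_mult_index[OF W C ib] using ib by (intro sum.cong) (auto simp: W_def C_def)
    finally show "X $$ (i, b) = (W * C) $$ (i, b)" .
  qed (use Xc W C in auto)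
  have WXD: "W = X * D"
  proof (rule eq_matI)
    fix i j assume "i < dim_row (X * D)" "j < dim_col (X * D)"
    then have ij: "i < n" "j < r" using Xc D by auto
    have "X * V = U * mat_diag m s * (mat_adjoint V * V)"
      unfolding X by (rule assoc_mult_mat[OF UD mat_adjoint_carrier[OF Vc] Vc])
    then have XV: "X * V = U * mat_diag m s"
      unfolding VV right_mult_one_mat[OF UD] .
    have "(X * D) $$ (i, j) = (\<Sum>b<m. X $$ (i, b) * V $$ (b, j) / s j)"
      unfolding mat_mult_index[OF Xc D ij] using ij by (intro sum.cong) (auto simp: D_def)
    also have "\<dots> = (X * V) $$ (i, j) / s j"
      using ij r by (subst mat_mult_index[OF Xc Vc]) (auto simp: sum_divide_distrib)
    also have "\<dots> = W $$ (i, j)"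
      unfolding XV mat_diag_mult_right[OF U(1)] using ij r(1) r(2)[of j] by (simp add: W_def)
    finally show "W $$ (i, j) = (X * D) $$ (i, j)" by simp
  qed (use Xc W D in auto)
  have "col_space X = col_space W"
  proof
    show "col_space X \<subseteq> col_space W"
    proof
      fix y assume "y \<in> col_space X"
      then obtain x where x: "x \<in> carrier_vec m" "y = X *\<^sub>v x"
        unfolding col_space_eq[OF Xc] using Xc by auto
      then have "y = W *\<^sub>v (C *\<^sub>v x)" unfolding XWC using W C by simp
      then show "y \<in> col_space W"
        unfolding col_space_eq[OF W] using W C x by auto
    qed
    show "col_space W \<subseteq> col_space X"
    proof
      fix y assume "y \<in> col_space W"
      then obtain x where x: "x \<in> carrier_vec r" "y = W *\<^sub>v x"
        unfolding col_space_eq[OF W] using W by auto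
      then have "y = X *\<^sub>v (D *\<^sub>v x)" unfolding WXD using Xc D by simp
      then show "y \<in> col_space X"
        unfolding col_space_eq[OF Xc] using Xc D x by auto
    qed
  qed
  then have "rank X = rank W" unfolding rank_def col_space_def by simp
  have colW: "col W j = col U j" if "j < r" for j
    using U(1) r(1) that by (intro eq_vecI) (auto simp: W_def)
  have gram: "(mat_adjoint W * W) $$ (i, j) = (if i = j then 1 else 0)" if "i < r" "j < r" for i j
  proof -
    have "(mat_adjoint W * W) $$ (i, j) = (mat_adjoint U * U) $$ (i, j)"
      using that r(1) colW gram_index[OF W W that] gram_index[OF U(1) U(1), of i j] by simp
    then show ?thesis unfolding U(2) using that r(1) by simp
  qed
  then have WW: "mat_adjoint W * W = 1\<^sub>m r"
    using W by (intro eq_matI) auto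
  have dist: "distinct (cols W)"
    unfolding distinct_conv_nth
  proof (intro allI impI)
    fix i j assume "i < length (cols W)" "j < length (cols W)" "i \<noteq> j"
    then have ij: "i < r" "j < r" "i \<noteq> j" using W by auto
    show "cols W ! i \<noteq> cols W ! j"
    proof
      assume "cols W ! i = cols W ! j"
      then have "col W i = col W j" using ij W by simp
      then have "(mat_adjoint W * W) $$ (i, j) = (mat_adjoint W * W) $$ (i, i)"
        using ij by (simp add: gram_index[OF W W] del: index_mult_mat)
      then show False using gram ij by simp
    qed
  qed
  have "lin_indpt (set (cols W))"
  proof
    assume "lin_dep (set (cols W))"
    then obtain v where v: "v \<in> carrier_vec r" "v \<noteq> 0\<^sub>v r" "W *\<^sub>v v = 0\<^sub>v n"
      using lin_depE[OF W _ dist] by blast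
    \<comment> \<open>The Gram matrix of \<open>W\<close> is the identity, so a vector in the kernel
      of \<open>W\<close> is zero.\<close>
    have "v = (mat_adjoint W * W) *\<^sub>v v" unfolding WW using v by simp
    also have "\<dots> = mat_adjoint W *\<^sub>v (W *\<^sub>v v)"
      using W v by (intro assoc_mult_mat_vec) auto
    also have "\<dots> = 0\<^sub>v r" unfolding v(3) using W by (intro eq_vecI) auto
    finally show False using v(2) by simp
  qed
  then have "rank W = r" by (rule lin_indpt_full_rank[OF W dist])
  with \<open>rank X = rank W\<close> show ?thesis by simp
qed

section \<open>Stationary points\<close>

text \<open>The Euclidean gradient of the objective of qTPM with respect to the real inner product
  Re tr(X^* Y).\<close>

definition qtpm_gradient :: "complex mat \<Rightarrow> real \<Rightarrow> complex mat \<Rightarrow> complex mat" where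
  "qtpm_gradient A \<mu> X = A * X + complex_of_real \<mu> \<cdot>\<^sub>m (X * mat_adjoint X * X)"

lemma qtpm_gradient_carrier:
  assumes "A \<in> carrier_mat n n" "X \<in> carrier_mat n p"
  shows "qtpm_gradient A \<mu> X \<in> carrier_mat n p"
  using assms unfolding qtpm_gradient_def by (intro add_carrier_mat smult_carrier_mat) auto

text \<open>A diagonal factor on the right only scales columns, so the matrix equation splits into
  independent conditions on the columns and the multipliers can be found one column at a
  time.\<close>

lemma qtpm_stationary_iff:
  assumes A: "A \<in> carrier_mat n n"
  shows "qtpm_stationary A \<mu> n p X \<longleftrightarrow> X \<in> oblique n p \<and>
    (\<exists>d. \<forall>x<n. \<forall>j<p. qtpm_gradient A \<mu> X $$ (x, j) = - complex_of_real (d j) * X $$ (x, j))"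
proof (cases "X \<in> oblique n p")
  case True
  then have X: "X \<in> carrier_mat n p" by (simp add: oblique_def)
  note c = qtpm_gradient_carrier[OF A X, of \<mu>]
  have "qtpm_gradient A \<mu> X + X * mat_diag p (\<lambda>j. complex_of_real (d j)) = 0\<^sub>m n p \<longleftrightarrow>
    (\<forall>x<n. \<forall>j<p. qtpm_gradient A \<mu> X $$ (x, j) = - complex_of_real (d j) * X $$ (x, j))" for d
    unfolding mat_diag_mult_right[OF X] mat_eq_iff using carrier_matD[OF c]
    by (auto simp: eq_neg_iff_add_eq_0 mult.commute)
  then show ?thesis
    unfolding qtpm_stationary_def qtpm_gradient_def[symmetric] by simp
next
  case False
  then show ?thesis by (simp add: qtpm_stationary_def)
qed

text \<open>The factor W cancels in (X W)(X W)^* = X X^*.\<close>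

lemma qtpm_gradient_mult_unitary:
  assumes A: "A \<in> carrier_mat n n" and X: "X \<in> carrier_mat n p" and W: "is_unitary p W"
  shows "qtpm_gradient A \<mu> (X * W) = qtpm_gradient A \<mu> X * W"
proof -
  have Wc: "W \<in> carrier_mat p p" and WW: "W * mat_adjoint W = 1\<^sub>m p"
    using W by (auto simp: is_unitary_def)
  have Xa: "mat_adjoint X \<in> carrier_mat p n" and Wa: "mat_adjoint W \<in> carrier_mat p p"
    and XX: "X * mat_adjoint X \<in> carrier_mat n n" and XXX: "X * mat_adjoint X * X \<in> carrier_mat n p"
    and XW: "X * W \<in> carrier_mat n p" and AX: "A * X \<in> carrier_mat n p"
    using A X Wc by auto
  have "X * W * mat_adjoint (X * W) = (X * W * mat_adjoint W) * mat_adjoint X"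
    unfolding mat_adjoint_mult[OF X Wc] by (rule assoc_mult_mat[OF XW Wa Xa, symmetric])
  also have "X * W * mat_adjoint W = X * (W * mat_adjoint W)"
    by (rule assoc_mult_mat[OF X Wc Wa])
  also have "\<dots> = X" unfolding WW using X by simp
  finally have "qtpm_gradient A \<mu> (X * W) =
      A * (X * W) + complex_of_real \<mu> \<cdot>\<^sub>m (X * mat_adjoint X * (X * W))"
    by (simp add: qtpm_gradient_def)
  also have "\<dots> = A * X * W + complex_of_real \<mu> \<cdot>\<^sub>m (X * mat_adjoint X * X * W)"
    using assoc_mult_mat[OF A X Wc] assoc_mult_mat[OF XX X Wc] by simp
  also have "\<dots> = qtpm_gradient A \<mu> X * W"
    unfolding qtpm_gradient_def
    by (subst add_mult_distrib_mat[OF AX _ Wc])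
      (use XXX mult_smult_assoc_mat[OF XXX Wc] in auto)
  finally show ?thesis .
qed

text \<open>The multipliers are permuted together with the columns, whose lengths stay the
  same.\<close>

lemma qtpm_stationary_permute:
  assumes A: "A \<in> carrier_mat n n" and X: "qtpm_stationary A \<mu> n p X"
    and \<pi>: "\<pi> permutes {..<p}"
  shows "qtpm_stationary A \<mu> n p (X * perm_mat p \<pi>)"
proof -
  from X obtain d where ob: "X \<in> oblique n p"
    and d: "\<And>x j. x < n \<Longrightarrow> j < p \<Longrightarrow> qtpm_gradient A \<mu> X $$ (x, j) = - complex_of_real (d j) * X $$ (x, j)"
    unfolding qtpm_stationary_iff[OF A] by blast
  have Xc: "X \<in> carrier_mat n p" using ob by (simp add: oblique_def)
  have Yc: "X * perm_mat p \<pi> \<in> carrier_mat n p"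
    by (rule mult_carrier_mat[OF Xc perm_mat_carrier])
  have lt: "\<pi> j < p" if "j < p" for j using permutes_in_image[OF \<pi>, of j] that by simp
  have Y: "(X * perm_mat p \<pi>) $$ (x, j) = X $$ (x, \<pi> j)" if "x < n" "j < p" for x j
    unfolding mult_perm_mat[OF Xc \<pi>] using that by simp
  have "(mat_adjoint (X * perm_mat p \<pi>) * (X * perm_mat p \<pi>)) $$ (j, j) = 1" if j: "j < p" for j
  proof -
    have "(mat_adjoint (X * perm_mat p \<pi>) * (X * perm_mat p \<pi>)) $$ (j, j) =
        complex_of_real (\<Sum>i<n. (cmod (X $$ (i, \<pi> j)))\<^sup>2)"
      unfolding gram_diag_index[OF Yc j] using Y j by simp
    also have "\<dots> = (mat_adjoint X * X) $$ (\<pi> j, \<pi> j)"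
      by (rule gram_diag_index[OF Xc lt[OF j], symmetric])
    finally show ?thesis using ob lt[OF j] by (simp add: oblique_def)
  qed
  then have "X * perm_mat p \<pi> \<in> oblique n p" using Yc by (simp add: oblique_def)
  moreover have "qtpm_gradient A \<mu> (X * perm_mat p \<pi>) $$ (x, j) =
      - complex_of_real (d (\<pi> j)) * (X * perm_mat p \<pi>) $$ (x, j)" if "x < n" "j < p" for x j
    unfolding Y[OF that] qtpm_gradient_mult_unitary[OF A Xc perm_mat_unitary[OF \<pi>]]
      mult_perm_mat[OF qtpm_gradient_carrier[OF A Xc] \<pi>]
    using d lt that by simp
  ultimately show ?thesis
    unfolding qtpm_stationary_iff[OF A] by (intro conjI exI[of _ "\<lambda>j. d (\<pi> j)"]) auto
qed

text \<open>With the cubic term bracketed as X (X^* X), block diagonality of the Gram matrix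
  confines it to single blocks.\<close>

lemma qtpm_gradient_hcat:
  assumes A: "A \<in> carrier_mat n n" and B: "\<And>i. i < k \<Longrightarrow> B i \<in> carrier_mat n (q i)"
    and orth: "\<And>i j. i < k \<Longrightarrow> j < k \<Longrightarrow> i \<noteq> j \<Longrightarrow> mat_adjoint (B i) * B j = 0\<^sub>m (q i) (q j)"
  shows "qtpm_gradient A \<mu> (hcat n k B) = hcat n k (\<lambda>i. qtpm_gradient A \<mu> (B i))"
proof (rule block_mat_eqI[of _ n q k])
  have H: "hcat n k B \<in> carrier_mat n (block_offset q k)" using B by (rule hcat_carrier)
  show "qtpm_gradient A \<mu> (hcat n k B) \<in> carrier_mat n (block_offset q k)"
    by (rule qtpm_gradient_carrier[OF A H])
  have g: "qtpm_gradient A \<mu> (B i) \<in> carrier_mat n (q i)" if "i < k" for i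
    by (rule qtpm_gradient_carrier[OF A B[OF that]])
  then show "hcat n k (\<lambda>i. qtpm_gradient A \<mu> (B i)) \<in> carrier_mat n (block_offset q k)"
    by (rule hcat_carrier)
  have GB: "mat_adjoint (B i) * B i \<in> carrier_mat (q i) (q i)" if "i < k" for i
    using B[OF that] by auto
  have BGB: "B i * (mat_adjoint (B i) * B i) \<in> carrier_mat n (q i)" if "i < k" for i
    using B[OF that] by auto
  have AB: "A * B i \<in> carrier_mat n (q i)" if "i < k" for i
    using A B[OF that] by auto
  have gram: "mat_adjoint (hcat n k B) * hcat n k B = block_diag k (\<lambda>i. mat_adjoint (B i) * B i)"
    by (rule gram_hcat[OF B orth])
  have mult: "A * hcat n k B = hcat n k (\<lambda>i. A * B i)"
    by (rule mult_hcat[OF A B])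
  have "hcat n k B * mat_adjoint (hcat n k B) * hcat n k B =
      hcat n k B * (mat_adjoint (hcat n k B) * hcat n k B)"
    by (rule assoc_mult_mat[OF H mat_adjoint_carrier[OF H] H])
  also have "\<dots> = hcat n k (\<lambda>i. B i * (mat_adjoint (B i) * B i))"
    unfolding gram by (rule hcat_mult_block_diag[OF B GB])
  finally have cube: "hcat n k B * mat_adjoint (hcat n k B) * hcat n k B =
    hcat n k (\<lambda>i. B i * (mat_adjoint (B i) * B i))" .
  fix x i a assume *: "x < n" "i < k" "a < q i"
  have lt: "block_offset q i + a < block_offset q k" using * by (intro block_index_less)
  have assoc: "B i * mat_adjoint (B i) * B i = B i * (mat_adjoint (B i) * B i)"
    by (rule assoc_mult_mat) (use B[OF *(2)] in auto)
  have "qtpm_gradient A \<mu> (hcat n k B) $$ (x, block_offset q i + a) =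
      (A * B i) $$ (x, a) + complex_of_real \<mu> * (B i * (mat_adjoint (B i) * B i)) $$ (x, a)"
    unfolding qtpm_gradient_def cube mult
    using hcat_index[of k "\<lambda>i. A * B i" n q, OF AB *(2,3,1)]
      hcat_index[of k "\<lambda>i. B i * (mat_adjoint (B i) * B i)" n q, OF BGB *(2,3,1)]
      carrier_matD[OF hcat_carrier[of k "\<lambda>i. A * B i" n q, OF AB]]
      carrier_matD[OF hcat_carrier[of k "\<lambda>i. B i * (mat_adjoint (B i) * B i)" n q, OF BGB]] lt *(1)
    by (simp del: index_mult_mat)
  also have "\<dots> = qtpm_gradient A \<mu> (B i) $$ (x, a)"
    unfolding qtpm_gradient_def assoc
    using carrier_matD[OF AB[OF *(2)]] carrier_matD[OF BGB[OF *(2)]] *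
    by (simp del: index_mult_mat)
  also have "\<dots> = hcat n k (\<lambda>i. qtpm_gradient A \<mu> (B i)) $$ (x, block_offset q i + a)"
    using * g by (intro hcat_index[symmetric])
  finally show "qtpm_gradient A \<mu> (hcat n k B) $$ (x, block_offset q i + a) =
    hcat n k (\<lambda>i. qtpm_gradient A \<mu> (B i)) $$ (x, block_offset q i + a)" .
qed

text \<open>Since X X^* X V = X V D when X^* X V = V D, the cubic term turns into a scaling of the
  columns of X V. This makes the equation of one block linear column by column.\<close>

lemma qtpm_gradient_mult_diagonalizer:
  assumes A: "A \<in> carrier_mat n n" and X: "X \<in> carrier_mat n m" and V: "V \<in> carrier_mat m m"
    and GV: "mat_adjoint X * X * V = V * mat_diag m g" and xj: "x < n" "j < m"
  shows "(qtpm_gradient A \<mu> X * V) $$ (x, j) =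
    (A * (X * V)) $$ (x, j) + complex_of_real \<mu> * g j * (X * V) $$ (x, j)"
proof -
  have Xa: "mat_adjoint X \<in> carrier_mat m n" and G: "mat_adjoint X * X \<in> carrier_mat m m"
    and AX: "A * X \<in> carrier_mat n m" and XV: "X * V \<in> carrier_mat n m"
    and XXX: "X * mat_adjoint X * X \<in> carrier_mat n m"
    using A X V by auto
  have "X * mat_adjoint X * X * V = X * (mat_adjoint X * X) * V"
    using assoc_mult_mat[OF X Xa X] by simp
  also have "\<dots> = X * (V * mat_diag m g)"
    unfolding assoc_mult_mat[OF X G V] GV ..
  also have "\<dots> = X * V * mat_diag m g"
    by (rule assoc_mult_mat[OF X V mat_diag_dim, symmetric])
  finally have cube: "X * mat_adjoint X * X * V = X * V * mat_diag m g" .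
  have "qtpm_gradient A \<mu> X * V = A * X * V + (complex_of_real \<mu> \<cdot>\<^sub>m (X * mat_adjoint X * X)) * V"
    unfolding qtpm_gradient_def by (rule add_mult_distrib_mat[OF AX _ V]) (use XXX in auto)
  also have "\<dots> = A * (X * V) + complex_of_real \<mu> \<cdot>\<^sub>m (X * V * mat_diag m g)"
    unfolding mult_smult_assoc_mat[OF XXX V] cube assoc_mult_mat[OF A X V] ..
  finally show ?thesis
    unfolding mat_diag_mult_right[OF XV] using xj carrier_matD[OF XV] carrier_matD[OF A]
    by (simp del: index_mult_mat(1) add: mult_ac)
qed

lemma unitary_right_cancel:
  assumes V: "is_unitary m V" and B: "B \<in> carrier_mat n m" and C: "C \<in> carrier_mat n m"
    and eq: "B * V = C * V"
  shows "B = C"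
proof -
  have Vc: "V \<in> carrier_mat m m" and VV: "V * mat_adjoint V = 1\<^sub>m m"
    using V by (auto simp: is_unitary_def)
  have "B * V * mat_adjoint V = C * V * mat_adjoint V" unfolding eq ..
  then show ?thesis
    using assoc_mult_mat[OF B Vc mat_adjoint_carrier[OF Vc]] assoc_mult_mat[OF C Vc mat_adjoint_carrier[OF Vc]]
      B C unfolding VV by simp
qed

text \<open>Orthogonality of two column systems passes to linear combinations of them. It carries
  over from the U_i to the X_i in one direction of the proof and from the X_i to the X_i V_i in the
  other.\<close>

lemma gram_mult_zero:
  fixes U W C D :: "complex mat"
  assumes U: "U \<in> carrier_mat n a" and W: "W \<in> carrier_mat n b"
    and C: "C \<in> carrier_mat a c" and D: "D \<in> carrier_mat b d"
    and zero: "mat_adjoint U * W = 0\<^sub>m a b"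
  shows "mat_adjoint (U * C) * (W * D) = 0\<^sub>m c d"
proof -
  have "mat_adjoint (U * C) * (W * D) = mat_adjoint C * (mat_adjoint U * (W * D))"
    unfolding mat_adjoint_mult[OF U C] using U C W D by (intro assoc_mult_mat) auto
  also have "mat_adjoint U * (W * D) = mat_adjoint U * W * D"
    using U W D by (intro assoc_mult_mat[symmetric]) auto
  also have "\<dots> = 0\<^sub>m a d" unfolding zero using D by simp
  finally show ?thesis using C by simp
qed

lemma adjoint_real_diag [simp]:
  "mat_adjoint (mat_diag m (\<lambda>j. complex_of_real (s j))) = mat_diag m (\<lambda>j. complex_of_real (s j))"
  by (intro eq_matI) (auto simp: mat_diag_def)

lemma map_mat_real_diag:
  "map_mat complex_of_real (mat_diag m s) = mat_diag m (\<lambda>j. complex_of_real (s j))"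
  by (intro eq_matI) (auto simp: mat_diag_def)

text \<open>Column \<open>j\<close> of X V is \<open>s j\<close> times an eigenvector, and there the
  gradient acts as \<open>l j + \<mu> * (s j)\<^sup>2\<close>. Where \<open>s j\<close> is zero both
  sides vanish, so only the other columns have to share the constant \<open>c\<close>. The unitary V
  is cancelled at the end.\<close>

lemma qtpm_gradient_svd_block:
  assumes A: "A \<in> carrier_mat n n" and U: "U \<in> carrier_mat n m" "mat_adjoint U * U = 1\<^sub>m m"
    and V: "is_unitary m V"
    and X: "X = U * mat_diag m (\<lambda>j. complex_of_real (s j)) * mat_adjoint V"
    and ev: "\<And>j. j < m \<Longrightarrow> eigenvector A (col U j) (complex_of_real (l j))"
    and s: "\<And>j. j < m \<Longrightarrow> s j \<noteq> 0 \<Longrightarrow> l j + \<mu> * (s j)\<^sup>2 = c"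
  shows "qtpm_gradient A \<mu> X = complex_of_real c \<cdot>\<^sub>m X"
proof -
  let ?S = "mat_diag m (\<lambda>j. complex_of_real (s j))"
  have Vc: "V \<in> carrier_mat m m" and VV: "mat_adjoint V * V = 1\<^sub>m m"
    using V by (auto simp: is_unitary_def)
  have Va: "mat_adjoint V \<in> carrier_mat m m" and Ua: "mat_adjoint U \<in> carrier_mat m n" using Vc U by auto
  have S: "?S \<in> carrier_mat m m" by (rule mat_diag_dim)
  have US: "U * ?S \<in> carrier_mat n m" by (rule mult_carrier_mat[OF U(1) S])
  have Xc: "X \<in> carrier_mat n m" unfolding X by (rule mult_carrier_mat[OF US Va])
  have XV: "X * V = U * ?S"
    unfolding X assoc_mult_mat[OF US Va Vc] VV by (rule right_mult_one_mat[OF US])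
  have aX: "mat_adjoint X = V * (?S * mat_adjoint U)"
    unfolding X mat_adjoint_mult[OF US Va] mat_adjoint_mult[OF U(1) S] by simp
  have SU: "?S * mat_adjoint U \<in> carrier_mat m n" by (rule mult_carrier_mat[OF S Ua])
  \<comment> \<open>Since X^* = V S U^* and U^* U is the identity, only V S S remains.\<close>
  have "mat_adjoint X * X * V = mat_adjoint X * (U * ?S)"
    unfolding assoc_mult_mat[OF mat_adjoint_carrier[OF Xc] Xc Vc] XV ..
  also have "\<dots> = V * (?S * mat_adjoint U * (U * ?S))"
    unfolding aX by (rule assoc_mult_mat[OF Vc SU US])
  also have "?S * mat_adjoint U * (U * ?S) = ?S * (mat_adjoint U * (U * ?S))"
    by (rule assoc_mult_mat[OF S Ua US])
  also have "mat_adjoint U * (U * ?S) = ?S"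
    unfolding assoc_mult_mat[OF Ua U(1) S, symmetric] U(2) by (rule left_mult_one_mat[OF S])
  also have "?S * ?S = mat_diag m (\<lambda>j. complex_of_real ((s j)\<^sup>2))"
    by (simp add: power2_eq_square)
  finally have GV: "mat_adjoint X * X * V = V * mat_diag m (\<lambda>j. complex_of_real ((s j)\<^sup>2))" .
  have gc: "qtpm_gradient A \<mu> X \<in> carrier_mat n m" by (rule qtpm_gradient_carrier[OF A Xc])
  have "qtpm_gradient A \<mu> X * V = (complex_of_real c \<cdot>\<^sub>m X) * V"
    unfolding mult_smult_assoc_mat[OF Xc Vc]
  proof (rule eq_matI)
    fix x j assume "x < dim_row (complex_of_real c \<cdot>\<^sub>m (X * V))" "j < dim_col (complex_of_real c \<cdot>\<^sub>m (X * V))"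
    then have xj: "x < n" "j < m" using Xc Vc by auto
    have AU: "A * U \<in> carrier_mat n m" using A U by auto
    have US_index: "(U * ?S) $$ (x, j) = U $$ (x, j) * complex_of_real (s j)"
      unfolding mat_diag_mult_right[OF U(1)] using xj by simp
    have "(A * U) $$ (x, j) = (A *\<^sub>v col U j) $ x" using A U xj by simp
    also have "\<dots> = complex_of_real (l j) * U $$ (x, j)"
      using ev[OF xj(2)] U xj by (simp add: eigenvector_def)
    finally have "(A * (U * ?S)) $$ (x, j) = complex_of_real (l j) * U $$ (x, j) * complex_of_real (s j)"
      unfolding assoc_mult_mat[OF A U(1) S, symmetric] mat_diag_mult_right[OF AU] using xj by simp
    then have "(qtpm_gradient A \<mu> X * V) $$ (x, j) =
        complex_of_real (l j + \<mu> * (s j)\<^sup>2) * (U $$ (x, j) * complex_of_real (s j))"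
      unfolding qtpm_gradient_mult_diagonalizer[OF A Xc Vc GV xj] XV US_index
      by (simp add: algebra_simps)
    also have "\<dots> = complex_of_real c * (U $$ (x, j) * complex_of_real (s j))"
      using s[OF xj(2)] by (cases "s j = 0") auto
    finally show "(qtpm_gradient A \<mu> X * V) $$ (x, j) = (complex_of_real c \<cdot>\<^sub>m (X * V)) $$ (x, j)"
      unfolding XV US_index[symmetric] using xj carrier_matD[OF US] by (simp del: index_mult_mat(1))
  qed (use gc Xc Vc in auto)
  then show ?thesis
    by (rule unitary_right_cancel[OF V gc smult_carrier_mat[OF Xc]])
qed

section \<open>From the block conditions to stationarity\<close>

lemma block_conditions_imp_stationary:
  assumes A: "A \<in> carrier_mat n n" and \<mu>: "\<mu> > 0"
    and cond: "qtpm_block_conditions A \<mu> n p X k q r Xb U S V lam"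
  shows "qtpm_stationary A \<mu> n p X"
proof -
  note C = cond[unfolded qtpm_block_conditions_def]
  have p: "block_offset q k = p" using C by (simp add: block_offset_def)
  have X: "X = hcat n k Xb" using C by blast
  have Xb: "Xb i \<in> carrier_mat n (q i)" and obl: "Xb i \<in> oblique n (q i)"
    and svd: "is_svd n (q i) (Xb i) (U i) (S i) (V i)"
    and ev: "\<And>j. j < q i \<Longrightarrow> eigenvector A (col (U i) j) (complex_of_real (lam i j))"
    if "i < k" for i
    using C that by blast+
  have Ui: "U i \<in> carrier_mat n (q i)" "mat_adjoint (U i) * U i = 1\<^sub>m (q i)"
    and Vi: "is_unitary (q i) (V i)" and Snn: "\<And>j. j < q i \<Longrightarrow> S i $$ (j, j) \<ge> 0"
    and Xi: "Xb i = U i * map_mat complex_of_real (S i) * mat_adjoint (V i)"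
    if "i < k" for i
    using svd[OF that] by (auto simp: is_svd_def)
  define s where "s i j = (if j < r i
        then sqrt (real (q i) / real (r i)
               - 1 / \<mu> * (lam i j - 1 / real (r i) * (\<Sum>l<r i. lam i l)))
        else 0)" for i j
  \<comment> \<open>Solving the formula for the singular values for
    \<open>lam i j + \<mu> * (s i j)\<^sup>2\<close> gives this value, which does not depend on
    \<open>j\<close>.\<close>
  define c where "c i = \<mu> * (real (q i) / real (r i)) + 1 / real (r i) * (\<Sum>l<r i. lam i l)" for i
  have S: "S i = mat_diag (q i) (s i)" if "i < k" for i
    using C that unfolding s_def by blast
  have Xs: "Xb i = U i * mat_diag (q i) (\<lambda>j. complex_of_real (s i j)) * mat_adjoint (V i)" if "i < k" for i
    using Xi[OF that] unfolding S[OF that] map_mat_real_diag .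
  have grad: "qtpm_gradient A \<mu> (Xb i) = complex_of_real (c i) \<cdot>\<^sub>m Xb i" if i: "i < k" for i
  proof (rule qtpm_gradient_svd_block[OF A Ui[OF i] Vi[OF i] Xs[OF i] ev[OF i]])
    fix j assume j: "j < q i" "s i j \<noteq> 0"
    let ?t = "real (q i) / real (r i) - 1 / \<mu> * (lam i j - 1 / real (r i) * (\<Sum>l<r i. lam i l))"
    \<comment> \<open>The real \<open>sqrt\<close> is negative on negative numbers, so nonnegativity
      of the singular value shows that the radicand is nonnegative and that squaring recovers
      it.\<close>
    have "s i j \<ge> 0" using Snn[OF i j(1)] j unfolding S[OF i] by (simp add: mat_diag_def)
    moreover have "s i j = sqrt ?t" using j(2) unfolding s_def by presburger
    ultimately have "(s i j)\<^sup>2 = ?t" by simp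
    then show "lam i j + \<mu> * (s i j)\<^sup>2 = c i"
      using \<mu> unfolding c_def by (simp add: right_diff_distrib)
  qed auto
  have gramU: "mat_adjoint (hcat n k U) * hcat n k U = 1\<^sub>m p" using C by blast
  \<comment> \<open>These are the off-diagonal blocks of the identity matrix U^* U.\<close>
  have orthU: "mat_adjoint (U i) * U j = 0\<^sub>m (q i) (q j)" if ij: "i < k" "j < k" "i \<noteq> j" for i j
  proof (rule eq_matI)
    fix a b assume "a < dim_row (0\<^sub>m (q i) (q j) :: complex mat)" "b < dim_col (0\<^sub>m (q i) (q j) :: complex mat)"
    then have ab: "a < q i" "b < q j" by auto
    have "(mat_adjoint (U i) * U j) $$ (a, b) = 1\<^sub>m p $$ (block_offset q i + a, block_offset q j + b)"
      unfolding gramU[symmetric] using gram_hcat_index[of k U n q i a j b] Ui ij ab by simp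
    also have "\<dots> = 0"
      using ij ab block_index_less[of i k a q] block_index_less[of j k b q] p
      by (simp add: block_index_inj)
    finally show "(mat_adjoint (U i) * U j) $$ (a, b) = 0\<^sub>m (q i) (q j) $$ (a, b)"
      using ab by simp
  qed (use carrier_matD[OF Ui(1)[OF ij(1)]] carrier_matD[OF Ui(1)[OF ij(2)]] in auto)
  have orth: "mat_adjoint (Xb i) * Xb j = 0\<^sub>m (q i) (q j)" if ij: "i < k" "j < k" "i \<noteq> j" for i j
  proof -
    have Vc: "mat_adjoint (V i) \<in> carrier_mat (q i) (q i)" if "i < k" for i
      using Vi[OF that] by (simp add: is_unitary_def)
    have SV: "mat_diag (q i) (\<lambda>j. complex_of_real (s i j)) * mat_adjoint (V i) \<in> carrier_mat (q i) (q i)" if "i < k" for i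
      by (rule mult_carrier_mat[OF mat_diag_dim Vc[OF that]])
    show ?thesis
      unfolding Xs[OF ij(1)] Xs[OF ij(2)] assoc_mult_mat[OF Ui(1)[OF ij(1)] mat_diag_dim Vc[OF ij(1)]]
        assoc_mult_mat[OF Ui(1)[OF ij(2)] mat_diag_dim Vc[OF ij(2)]]
      by (rule gram_mult_zero[OF Ui(1)[OF ij(1)] Ui(1)[OF ij(2)] SV[OF ij(1)] SV[OF ij(2)] orthU[OF ij]])
  qed
  have Xc: "X \<in> carrier_mat n p" unfolding X p[symmetric] using Xb by (rule hcat_carrier)
  have "(mat_adjoint X * X) $$ (j, j) = 1" if "j < p" for j
  proof -
    obtain i a where ia: "i < k" "a < q i" "j = block_offset q i + a"
      using \<open>j < p\<close> unfolding p[symmetric] by (rule block_indexE)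
    then have "(mat_adjoint X * X) $$ (j, j) = (mat_adjoint (Xb i) * Xb i) $$ (a, a)"
      unfolding X using gram_hcat_index[of k Xb n q i a i a, OF Xb] by simp
    then show ?thesis using obl[OF ia(1)] ia(2) by (simp add: oblique_def)
  qed
  then have "X \<in> oblique n p" using Xc by (simp add: oblique_def)
  moreover have "\<exists>e. \<forall>x<n. qtpm_gradient A \<mu> X $$ (x, j) = - complex_of_real e * X $$ (x, j)"
    if "j < p" for j
  proof -
    obtain i a where ia: "i < k" "a < q i" "j = block_offset q i + a"
      using \<open>j < p\<close> unfolding p[symmetric] by (rule block_indexE)
    have gradX: "qtpm_gradient A \<mu> X = hcat n k (\<lambda>i. qtpm_gradient A \<mu> (Xb i))"
      unfolding X by (rule qtpm_gradient_hcat[OF A Xb orth])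
    \<comment> \<open>The multiplier of every column in block \<open>i\<close> is
      \<open>- c i\<close>, as the multipliers enter the equation on the other side.\<close>
    have "qtpm_gradient A \<mu> X $$ (x, j) = - complex_of_real (- c i) * X $$ (x, j)" if x: "x < n" for x
    proof -
      have "qtpm_gradient A \<mu> X $$ (x, j) = qtpm_gradient A \<mu> (Xb i) $$ (x, a)"
        unfolding gradX ia(3) 
        by (rule hcat_index[of k "\<lambda>i. qtpm_gradient A \<mu> (Xb i)" n q, OF qtpm_gradient_carrier[OF A Xb] ia(1,2) x])
      also have "\<dots> = complex_of_real (c i) * Xb i $$ (x, a)"
        unfolding grad[OF ia(1)] using carrier_matD[OF Xb[OF ia(1)]] x ia(2) by simp
      also have "Xb i $$ (x, a) = X $$ (x, j)"
        unfolding X ia(3) 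
        by (rule hcat_index[of k Xb n q, OF Xb ia(1,2) x, symmetric])
      finally show ?thesis by simp
    qed
    then show ?thesis by blast
  qed
  then have "\<exists>d. \<forall>x<n. \<forall>j<p. qtpm_gradient A \<mu> X $$ (x, j) = - complex_of_real (d j) * X $$ (x, j)"
    by metis
  ultimately show ?thesis unfolding qtpm_stationary_iff[OF A] by blast
qed

section \<open>Splitting a stationary point into orthogonal blocks\<close>

text \<open>Moving the Hermitian \<open>H\<close> across the scalar product of two columns compares
  their eigenvalues; the multipliers are real, so no conjugate appears on the right.\<close>

lemma gram_stationary_zero:
  assumes A: "A \<in> carrier_mat n n" and h: "hermitian A" and Y: "Y \<in> carrier_mat n p"
    and d: "\<And>x j. x < n \<Longrightarrow> j < p \<Longrightarrow> qtpm_gradient A \<mu> Y $$ (x, j) = - complex_of_real (d j) * Y $$ (x, j)"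
    and ab: "a < p" "b < p" "d a \<noteq> d b"
  shows "col Y a \<bullet>c col Y b = 0"
proof -
  define H where "H = A + complex_of_real \<mu> \<cdot>\<^sub>m (Y * mat_adjoint Y)"
  have YY: "Y * mat_adjoint Y \<in> carrier_mat n n" using Y by auto
  have mYY: "complex_of_real \<mu> \<cdot>\<^sub>m (Y * mat_adjoint Y) \<in> carrier_mat n n" using YY by simp
  have H: "H \<in> carrier_mat n n" unfolding H_def by (rule add_carrier_mat[OF mYY])
  have adjA: "cnj (A $$ (j, i)) = A $$ (i, j)" if "i < n" "j < n" for i j
  proof -
    have "cnj (A $$ (j, i)) = mat_adjoint A $$ (i, j)" using A that by simp
    also have "\<dots> = A $$ (i, j)" using h unfolding hermitian_def by simp
    finally show ?thesis .
  qed
  have adjY: "cnj ((Y * mat_adjoint Y) $$ (j, i)) = (Y * mat_adjoint Y) $$ (i, j)" if "i < n" "j < n" for i j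
  proof -
    have "mat_adjoint (Y * mat_adjoint Y) = Y * mat_adjoint Y"
      unfolding mat_adjoint_mult[OF Y mat_adjoint_carrier[OF Y]] by simp
    then show ?thesis
      using mat_adjoint_index[of i "Y * mat_adjoint Y" j] that carrier_matD[OF YY] by (simp del: index_mult_mat(1))
  qed
  have hH: "hermitian H"
  proof -
    have "mat_adjoint H = H"
      using adjA adjY A carrier_matD[OF YY] carrier_matD[OF H]
      by (intro eq_matI) (auto simp: H_def simp del: index_mult_mat(1))
    then show ?thesis using H by (simp add: hermitian_def)
  qed
  have HY: "H * Y = qtpm_gradient A \<mu> Y"
    unfolding H_def qtpm_gradient_def add_mult_distrib_mat[OF A mYY Y] mult_smult_assoc_mat[OF YY Y] ..
  have Hcol: "H *\<^sub>v col Y j = - complex_of_real (d j) \<cdot>\<^sub>v col Y j" if j: "j < p" for j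
  proof (rule eq_vecI)
    fix x assume "x < dim_vec (- complex_of_real (d j) \<cdot>\<^sub>v col Y j)"
    then have x: "x < n" using Y by simp
    have "(H *\<^sub>v col Y j) $ x = (H * Y) $$ (x, j)" using H Y x j by simp
    then show "(H *\<^sub>v col Y j) $ x = (- complex_of_real (d j) \<cdot>\<^sub>v col Y j) $ x"
      unfolding HY using d[OF x j] x j Y by simp
  qed (use H Y in auto)
  have c: "col Y a \<in> carrier_vec n" "col Y b \<in> carrier_vec n" using Y ab by auto
  have "- complex_of_real (d a) * (col Y a \<bullet>c col Y b) = - complex_of_real (d b) * (col Y a \<bullet>c col Y b)"
    using hermitian_scalar_prod[OF H hH c] c unfolding Hcol[OF ab(1)] Hcol[OF ab(2)]
    by (simp add: conjugate_smult_vec)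
  then show ?thesis using ab(3) by simp
qed

lemma stationary_decomposition:
  assumes A: "A \<in> carrier_mat n n" and h: "hermitian A" and Y: "qtpm_stationary A \<mu> n p Y"
  obtains \<rho> k q c Xb where "\<rho> permutes {..<p}" "block_offset q k = p"
    "Y * perm_mat p \<rho> = hcat n k Xb"
    "\<And>i. i < k \<Longrightarrow> q i \<ge> 1" "\<And>i. i < k \<Longrightarrow> Xb i \<in> oblique n (q i)"
    "\<And>i. i < k \<Longrightarrow> qtpm_gradient A \<mu> (Xb i) = complex_of_real (c i) \<cdot>\<^sub>m Xb i"
    "\<And>i j. i < k \<Longrightarrow> j < k \<Longrightarrow> i \<noteq> j \<Longrightarrow> mat_adjoint (Xb i) * Xb j = 0\<^sub>m (q i) (q j)"
proof -
  from Y obtain d where obl: "Y \<in> oblique n p"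
    and d: "\<And>x j. x < n \<Longrightarrow> j < p \<Longrightarrow> qtpm_gradient A \<mu> Y $$ (x, j) = - complex_of_real (d j) * Y $$ (x, j)"
    unfolding qtpm_stationary_iff[OF A] by blast
  have Yc: "Y \<in> carrier_mat n p" using obl by (simp add: oblique_def)
  \<comment> \<open>One block for each value of the multipliers: \<open>e\<close> enumerates these
    values, and \<open>f j\<close> is the number of the block that receives column
    \<open>j\<close>.\<close>
  define k where "k = card (d ` {..<p})"
  obtain e where e: "bij_betw e {..<k} (d ` {..<p})"
    using ex_bij_betw_nat_finite[of "d ` {..<p}"] by (auto simp: k_def atLeast0LessThan)
  define f where "f j = the_inv_into {..<k} e (d j)" for j
  have f: "f j < k" "e (f j) = d j" if "j < p" for j
  proof -
    have "d j \<in> e ` {..<k}" using e that by (auto simp: bij_betw_def)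
    then show "f j < k" "e (f j) = d j"
      using the_inv_into_into[of e "{..<k}" "d j" "{..<k}"] f_the_inv_into_f[of e "{..<k}" "d j"] e
      by (auto simp: f_def bij_betw_def)
  qed
  define q where "q i = card {j. j < p \<and> f j = i}" for i
  have p: "block_offset q k = p"
    using f(1) by (rule grouping_permutation(1)) (auto simp: q_def)
  obtain \<rho> where \<rho>: "\<rho> permutes {..<p}"
    and f\<rho>: "\<And>i a. i < k \<Longrightarrow> a < q i \<Longrightarrow> f (\<rho> (block_offset q i + a)) = i"
    using grouping_permutation(2)[of p f k q, OF f(1) q_def] by blast
  have lt: "\<rho> (block_offset q i + a) < p" if "i < k" "a < q i" for i a
    using permutes_in_image[OF \<rho>, of "block_offset q i + a"] block_index_less[of i k a q] that p by simp
  have dval: "d (\<rho> (block_offset q i + a)) = e i" if "i < k" "a < q i" for i a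
    using f(2)[OF lt[OF that]] f\<rho>[OF that] by simp
  define Xb where "Xb i = mat n (q i) (\<lambda>(x, a). Y $$ (x, \<rho> (block_offset q i + a)))" for i
  have Xb: "Xb i \<in> carrier_mat n (q i)" for i by (simp add: Xb_def)
  have colXb: "col (Xb i) a = col Y (\<rho> (block_offset q i + a))" if "i < k" "a < q i" for i a
    using Yc lt[OF that] that by (intro eq_vecI) (auto simp: Xb_def)
  have Xc: "Y * perm_mat p \<rho> \<in> carrier_mat n p" by (rule mult_carrier_mat[OF Yc perm_mat_carrier])
  have X: "Y * perm_mat p \<rho> = hcat n k Xb"
  proof (rule block_mat_eqI[of _ n q k])
    show "hcat n k Xb \<in> carrier_mat n (block_offset q k)" using Xb by (rule hcat_carrier)
    fix x i a assume *: "x < n" "i < k" "a < q i"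
    have "(Y * perm_mat p \<rho>) $$ (x, block_offset q i + a) = Xb i $$ (x, a)"
      unfolding mult_perm_mat[OF Yc \<rho>] using * block_index_less[of i k a q] p by (simp add: Xb_def)
    also have "\<dots> = hcat n k Xb $$ (x, block_offset q i + a)"
      by (rule hcat_index[of k Xb n q, OF Xb *(2,3,1), symmetric])
    finally show "(Y * perm_mat p \<rho>) $$ (x, block_offset q i + a) = hcat n k Xb $$ (x, block_offset q i + a)" .
  qed (use Xc p in simp)
  have orth: "mat_adjoint (Xb i) * Xb j = 0\<^sub>m (q i) (q j)" if ij: "i < k" "j < k" "i \<noteq> j" for i j
  proof (rule eq_matI)
    fix a b assume "a < dim_row (0\<^sub>m (q i) (q j) :: complex mat)" "b < dim_col (0\<^sub>m (q i) (q j) :: complex mat)"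
    then have ab: "a < q i" "b < q j" by auto
    have "e i \<noteq> e j" using e ij by (auto simp: bij_betw_def inj_on_def)
    then have "col Y (\<rho> (block_offset q j + b)) \<bullet>c col Y (\<rho> (block_offset q i + a)) = 0"
      using gram_stationary_zero[OF A h Yc d lt[OF ij(2) ab(2)] lt[OF ij(1) ab(1)]]
        dval[OF ij(1) ab(1)] dval[OF ij(2) ab(2)] by simp
    then show "(mat_adjoint (Xb i) * Xb j) $$ (a, b) = 0\<^sub>m (q i) (q j) $$ (a, b)"
      unfolding gram_index[OF Xb Xb ab] colXb[OF ij(1) ab(1)] colXb[OF ij(2) ab(2)] using ab by simp
  qed (use carrier_matD[OF Xb] in auto)
  \<comment> \<open>Each enumerated value is the multiplier of some column, so no block is
    empty.\<close>
  have qpos: "q i \<ge> 1" if "i < k" for i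
  proof -
    have "e i \<in> d ` {..<p}" using e that by (auto simp: bij_betw_def)
    then obtain j where j: "j < p" "d j = e i" by auto
    then have "e (f j) = e i" using f(2) by simp
    then have "f j = i" using e that f(1)[OF j(1)] by (auto simp: bij_betw_def inj_on_def)
    then have "j \<in> {j. j < p \<and> f j = i}" using j by simp
    moreover have "finite {j. j < p \<and> f j = i}" by simp
    ultimately show ?thesis unfolding q_def by (metis One_nat_def Suc_leI card_gt_0_iff empty_iff)
  qed
  have obX: "Xb i \<in> oblique n (q i)" if i: "i < k" for i
  proof -
    have "(mat_adjoint (Xb i) * Xb i) $$ (a, a) = 1" if a: "a < q i" for a
      unfolding gram_index[OF Xb Xb a a] colXb[OF i a]
      using obl lt[OF i a] gram_index[OF Yc Yc lt[OF i a] lt[OF i a]] by (simp add: oblique_def del: index_mult_mat(1))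
    then show ?thesis using Xb by (simp add: oblique_def)
  qed
  \<comment> \<open>The gradient of the permuted matrix is computed in two ways: as the permuted
    gradient of \<open>Y\<close>, and block by block thanks to orthogonality. Comparing columns
    gives the equation of each block with the constant \<open>- e i\<close>.\<close>
  have gradX: "qtpm_gradient A \<mu> Y * perm_mat p \<rho> = hcat n k (\<lambda>i. qtpm_gradient A \<mu> (Xb i))"
    using qtpm_gradient_hcat[of A n k Xb q \<mu>, OF A Xb orth]
    unfolding X[symmetric] qtpm_gradient_mult_unitary[OF A Yc perm_mat_unitary[OF \<rho>]] by simp
  have grad: "qtpm_gradient A \<mu> (Xb i) = complex_of_real (- e i) \<cdot>\<^sub>m Xb i" if i: "i < k" for i
  proof (rule eq_matI)
    fix x a assume "x < dim_row (complex_of_real (- e i) \<cdot>\<^sub>m Xb i)" "a < dim_col (complex_of_real (- e i) \<cdot>\<^sub>m Xb i)"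
    then have xa: "x < n" "a < q i" using carrier_matD[OF Xb[of i]] by auto
    have "qtpm_gradient A \<mu> (Xb i) $$ (x, a) = (qtpm_gradient A \<mu> Y * perm_mat p \<rho>) $$ (x, block_offset q i + a)"
      unfolding gradX
      by (rule hcat_index[of k "\<lambda>i. qtpm_gradient A \<mu> (Xb i)" n q, OF qtpm_gradient_carrier[OF A Xb] i xa(2,1), symmetric])
    also have "\<dots> = qtpm_gradient A \<mu> Y $$ (x, \<rho> (block_offset q i + a))"
      unfolding mult_perm_mat[OF qtpm_gradient_carrier[OF A Yc] \<rho>]
      using xa block_index_less[of i k a q] i p by simp
    also have "\<dots> = complex_of_real (- e i) * Xb i $$ (x, a)"
      unfolding d[OF xa(1) lt[OF i xa(2)]] dval[OF i xa(2)] using xa by (simp add: Xb_def)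
    finally show "qtpm_gradient A \<mu> (Xb i) $$ (x, a) = (complex_of_real (- e i) \<cdot>\<^sub>m Xb i) $$ (x, a)"
      using xa carrier_matD[OF Xb[of i]] by simp
  qed (use carrier_matD[OF Xb] carrier_matD[OF qtpm_gradient_carrier[OF A Xb]] in auto)
  show thesis
    by (rule that[OF \<rho> p X qpos obX grad orth])
qed

section \<open>Singular value decompositions of the blocks\<close>

lemma block_conditions_exist:
  assumes A: "A \<in> carrier_mat n n" and h: "hermitian A" and \<mu>: "\<mu> > 0" and pn: "p \<le> n"
    and p: "block_offset q k = p" and X: "X = hcat n k Xb"
    and q: "\<And>i. i < k \<Longrightarrow> q i \<ge> 1" and obl: "\<And>i. i < k \<Longrightarrow> Xb i \<in> oblique n (q i)"
    and grad: "\<And>i. i < k \<Longrightarrow> qtpm_gradient A \<mu> (Xb i) = complex_of_real (c i) \<cdot>\<^sub>m Xb i"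
    and orth: "\<And>i j. i < k \<Longrightarrow> j < k \<Longrightarrow> i \<noteq> j \<Longrightarrow> mat_adjoint (Xb i) * Xb j = 0\<^sub>m (q i) (q j)"
  shows "qtpm_block_form A \<mu> n p X"
proof -
  have Xb: "Xb i \<in> carrier_mat n (q i)" if "i < k" for i
    using obl[OF that] by (simp add: oblique_def)
  \<comment> \<open>The bound on \<open>i\<close> is moved inside the existential quantifiers so
    that \<open>V\<close>, \<open>r\<close> and \<open>g\<close> can be chosen as functions of
    \<open>i\<close>.\<close>
  have "\<forall>i. \<exists>V r g. i < k \<longrightarrow> is_unitary (q i) V \<and> r \<le> q i \<and> (\<forall>j<r. 0 < (g j :: real)) \<and>
      (\<forall>j<q i. r \<le> j \<longrightarrow> g j = 0) \<and>
      mat_adjoint (Xb i) * Xb i * V = V * mat_diag (q i) (\<lambda>j. complex_of_real (g j)) \<and>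
      mat_adjoint (Xb i * V) * (Xb i * V) = mat_diag (q i) (\<lambda>j. complex_of_real (g j))"
  proof
    fix i
    show "\<exists>V r g. i < k \<longrightarrow> is_unitary (q i) V \<and> r \<le> q i \<and> (\<forall>j<r. 0 < (g j :: real)) \<and>
      (\<forall>j<q i. r \<le> j \<longrightarrow> g j = 0) \<and>
      mat_adjoint (Xb i) * Xb i * V = V * mat_diag (q i) (\<lambda>j. complex_of_real (g j)) \<and>
      mat_adjoint (Xb i * V) * (Xb i * V) = mat_diag (q i) (\<lambda>j. complex_of_real (g j))"
    proof (cases "i < k")
      case True
      show ?thesis by (rule gram_diagonalization[OF Xb[OF True]]) blast
    qed simp
  qed
  then obtain V r g where VI: "\<forall>i. i < k \<longrightarrow> is_unitary (q i) (V i) \<and> r i \<le> q i \<and> (\<forall>j<r i. 0 < (g i j :: real)) \<and>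
      (\<forall>j<q i. r i \<le> j \<longrightarrow> g i j = 0) \<and>
      mat_adjoint (Xb i) * Xb i * V i = V i * mat_diag (q i) (\<lambda>j. complex_of_real (g i j)) \<and>
      mat_adjoint (Xb i * V i) * (Xb i * V i) = mat_diag (q i) (\<lambda>j. complex_of_real (g i j))"
    unfolding choice_iff by blast
  have V: "is_unitary (q i) (V i)" and rq: "r i \<le> q i" and gpos: "\<And>j. j < r i \<Longrightarrow> 0 < g i j"
    and gz: "\<And>j. j < q i \<Longrightarrow> r i \<le> j \<Longrightarrow> g i j = 0"
    and GV: "mat_adjoint (Xb i) * Xb i * V i = V i * mat_diag (q i) (\<lambda>j. complex_of_real (g i j))"
    and gram: "mat_adjoint (Xb i * V i) * (Xb i * V i) = mat_diag (q i) (\<lambda>j. complex_of_real (g i j))"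
    if "i < k" for i
    using VI that by blast+
  have Vc: "V i \<in> carrier_mat (q i) (q i)" and VV: "V i * mat_adjoint (V i) = 1\<^sub>m (q i)" "mat_adjoint (V i) * V i = 1\<^sub>m (q i)"
    if "i < k" for i
    using V[OF that] by (auto simp: is_unitary_def)
  \<comment> \<open>These will be the columns of U_i scaled by the singular values. They are
    orthogonal inside a block because V_i diagonalises the Gram matrix, and between blocks because
    the blocks are orthogonal.\<close>
  define w where "w i j = col (Xb i * V i) j" for i j
  have W: "Xb i * V i \<in> carrier_mat n (q i)" if "i < k" for i
    by (rule mult_carrier_mat[OF Xb[OF that] Vc[OF that]])
  have w: "w i j \<in> carrier_vec n" if "i < k" for i j
    using col_dim[of "Xb i * V i" j] carrier_matD[OF Xb[OF that]] by (simp add: w_def)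
  have ww: "w i j \<bullet>c w i' j' = (if i = i' \<and> j = j' then complex_of_real (g i j) else 0)"
    if ij: "i < k" "j < q i" "i' < k" "j' < q i'" for i j i' j'
  proof (cases "i = i'")
    case True
    have "w i j \<bullet>c w i j' = (mat_adjoint (Xb i * V i) * (Xb i * V i)) $$ (j', j)"
      unfolding w_def by (rule gram_index[OF W W, symmetric]) (use ij True in auto)
    then show ?thesis unfolding gram[OF ij(1)] using ij True by (auto simp: mat_diag_def)
  next
    case False
    have "w i j \<bullet>c w i' j' = (mat_adjoint (Xb i' * V i') * (Xb i * V i)) $$ (j', j)"
      unfolding w_def by (rule gram_index[OF W W, symmetric]) (use ij in auto)
    also have "mat_adjoint (Xb i' * V i') * (Xb i * V i) = 0\<^sub>m (q i') (q i)"
      by (rule gram_mult_zero[OF Xb Xb Vc Vc orth]) (use ij False in auto)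
    finally show ?thesis using ij False by simp
  qed
  \<comment> \<open>This is column \<open>j\<close> of the block equation multiplied by
    \<open>V i\<close>, after which the cubic term is the scaling by
    \<open>\<mu> * g i j\<close>.\<close>
  have Aw: "A *\<^sub>v w i j = complex_of_real (c i - \<mu> * g i j) \<cdot>\<^sub>v w i j" if ij: "i < k" "j < q i" for i j
  proof (rule eq_vecI)
    fix x assume "x < dim_vec (complex_of_real (c i - \<mu> * g i j) \<cdot>\<^sub>v w i j)"
    then have x: "x < n" using carrier_vecD[OF w[OF ij(1)]] by simp
    have "(A *\<^sub>v w i j) $ x = (A * (Xb i * V i)) $$ (x, j)"
      using A carrier_matD[OF W[OF ij(1)]] x ij by (simp add: w_def)
    also have "\<dots> = (qtpm_gradient A \<mu> (Xb i) * V i) $$ (x, j) - complex_of_real \<mu> * complex_of_real (g i j) * (Xb i * V i) $$ (x, j)"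
      unfolding qtpm_gradient_mult_diagonalizer[OF A Xb[OF ij(1)] Vc[OF ij(1)] GV[OF ij(1)] x ij(2)] by simp
    also have "(qtpm_gradient A \<mu> (Xb i) * V i) $$ (x, j) = complex_of_real (c i) * (Xb i * V i) $$ (x, j)"
      unfolding grad[OF ij(1)] mult_smult_assoc_mat[OF Xb[OF ij(1)] Vc[OF ij(1)]]
      using carrier_matD[OF W[OF ij(1)]] x ij by (simp del: index_mult_mat(1))
    also have "(Xb i * V i) $$ (x, j) = w i j $ x"
      using carrier_matD[OF W[OF ij(1)]] x ij by (simp add: w_def del: index_mult_mat(1))
    finally show "(A *\<^sub>v w i j) $ x = (complex_of_real (c i - \<mu> * g i j) \<cdot>\<^sub>v w i j) $ x"
      using carrier_vecD[OF w[OF ij(1)]] x by (simp add: algebra_simps)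
  qed (use A carrier_vecD[OF w[OF ij(1)]] in auto)
  \<comment> \<open>\<open>T\<close> indexes the nonzero singular values, whose vectors are already
    determined; \<open>T'\<close> indexes all columns. Extending over \<open>T'\<close> at once
    keeps the added vectors orthogonal across blocks.\<close>
  define T where "T = Sigma {..<k} (\<lambda>i. {..<r i})"
  define T' where "T' = Sigma {..<k} (\<lambda>i. {..<q i})"
  define u0 where "u0 = (\<lambda>(i, j). complex_of_real (1 / sqrt (g i j)) \<cdot>\<^sub>v w i j)"
  define lam0 where "lam0 = (\<lambda>(i, j). c i - \<mu> * g i j)"
  have "orthonormal_eigenvectors A n T u0 lam0"
    unfolding orthonormal_eigenvectors_def
  proof (intro conjI ballI)
    fix z assume "z \<in> T"
    then obtain i j where z: "z = (i, j)" and ij: "i < k" "j < r i" "j < q i"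
      using rq by (fastforce simp: T_def)
    show "u0 z \<in> carrier_vec n" using w[OF ij(1)] by (simp add: z u0_def)
    show "A *\<^sub>v u0 z = complex_of_real (lam0 z) \<cdot>\<^sub>v u0 z"
      using Aw[OF ij(1,3)] mult_mat_vec[OF A w[OF ij(1)]]
      by (simp add: z u0_def lam0_def smult_smult_assoc mult.commute)
    fix z' assume "z' \<in> T"
    then obtain i' j' where z': "z' = (i', j')" and ij': "i' < k" "j' < r i'" "j' < q i'"
      using rq by (fastforce simp: T_def)
    define t where "t = 1 / sqrt (g i j)"
    have t: "t * t * g i j = 1" using gpos[OF ij(1,2)] by (simp add: t_def field_simps)
    define t' where "t' = 1 / sqrt (g i' j')"
    have tt: "z = z' \<Longrightarrow> t' = t" by (simp add: z z' t_def t'_def)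
    have "u0 z \<bullet>c u0 z' = complex_of_real t * complex_of_real t' * (w i j \<bullet>c w i' j')"
      using w[OF ij(1), of j] w[OF ij'(1), of j']
      by (simp add: z z' u0_def conjugate_smult_vec mult_ac t_def t'_def)
    also have "\<dots> = (if z = z' then complex_of_real (t * t * g i j) else 0)"
      using tt unfolding ww[OF ij(1,3) ij'(1,3)] by (auto simp: z z')
    finally show "u0 z \<bullet>c u0 z' = (if z = z' then 1 else 0)" unfolding t by simp
  qed
  moreover have "finite T" "finite T'" "T \<subseteq> T'"
    using rq by (fastforce simp: T_def T'_def)+
  \<comment> \<open>There are exactly \<open>p\<close> pairs, and \<open>p \<le> n\<close> leaves
    room for that many orthonormal vectors.\<close>
  moreover have "card T' \<le> n"
    using pn p by (simp add: T'_def card_SigmaI block_offset_def)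
  ultimately obtain u lam where u: "orthonormal_eigenvectors A n T' u lam"
    and uT: "\<And>z. z \<in> T \<Longrightarrow> u z = u0 z \<and> lam z = lam0 z"
    using orthonormal_eigenvectors_extend[OF A h, of T T' u0 lam0] by blast
  have uc: "u (i, j) \<in> carrier_vec n" and Au: "A *\<^sub>v u (i, j) = complex_of_real (lam (i, j)) \<cdot>\<^sub>v u (i, j)"
    if "i < k" "j < q i" for i j
    using u that by (auto simp: orthonormal_eigenvectors_def T'_def)
  have uu: "u (i, j) \<bullet>c u (i', j') = (if i = i' \<and> j = j' then 1 else 0)"
    if "i < k" "j < q i" "i' < k" "j' < q i'" for i j i' j'
    using u that by (auto simp: orthonormal_eigenvectors_def T'_def)
  define U where "U i = mat n (q i) (\<lambda>(x, j). u (i, j) $ x)" for i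
  have U: "U i \<in> carrier_mat n (q i)" for i by (simp add: U_def)
  have colU: "col (U i) j = u (i, j)" if "i < k" "j < q i" for i j
    using carrier_vecD[OF uc[OF that]] that by (intro eq_vecI) (auto simp: U_def)
  have UU: "mat_adjoint (U i) * U j = (if i = j then 1\<^sub>m (q i) else 0\<^sub>m (q i) (q j))" if "i < k" "j < k" for i j
  proof (rule eq_matI)
    fix a b
    assume "a < dim_row (if i = j then 1\<^sub>m (q i) else 0\<^sub>m (q i) (q j) :: complex mat)"
      "b < dim_col (if i = j then 1\<^sub>m (q i) else 0\<^sub>m (q i) (q j) :: complex mat)"
    then have ab: "a < q i" "b < q j" by (auto split: if_splits)
    show "(mat_adjoint (U i) * U j) $$ (a, b) = (if i = j then 1\<^sub>m (q i) else 0\<^sub>m (q i) (q j)) $$ (a, b)"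
      unfolding gram_index[OF U U ab] colU[OF that(1) ab(1)] colU[OF that(2) ab(2)]
      using uu[OF that(2) ab(2) that(1) ab(1)] ab by auto
  qed (use carrier_matD[OF U[of i]] carrier_matD[OF U[of j]] in auto)
  \<comment> \<open>The columns of the block have length one, so its Gram matrix has trace
    \<open>q i\<close>; zero eigenvalues are dropped from the sum.\<close>
  have trace: "(\<Sum>j<r i. g i j) = real (q i)" if i: "i < k" for i
  proof -
    have Gc: "mat_adjoint (Xb i) * Xb i \<in> carrier_mat (q i) (q i)"
      by (rule mult_carrier_mat[OF mat_adjoint_carrier[OF Xb[OF i]] Xb[OF i]])
    have "(\<Sum>a<q i. (mat_adjoint (Xb i) * Xb i) $$ (a, a)) = (\<Sum>j<q i. complex_of_real (g i j))"
      by (rule gram_trace[OF Gc V[OF i] GV[OF i]])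
    moreover have "(\<Sum>a<q i. (mat_adjoint (Xb i) * Xb i) $$ (a, a)) = (\<Sum>a<q i. 1)"
      using obl[OF i] by (intro sum.cong) (auto simp: oblique_def)
    ultimately have "complex_of_real (real (q i)) = complex_of_real (\<Sum>j<q i. g i j)" by simp
    then have "real (q i) = (\<Sum>j<q i. g i j)" using of_real_eq_iff by blast
    also have "\<dots> = (\<Sum>j<r i. g i j)"
      using rq[OF i] gz[OF i] by (intro sum.mono_neutral_right) auto
    finally show ?thesis by simp
  qed
  \<comment> \<open>With \<open>r i = 0\<close> the trace would be an empty sum, although
    \<open>q i\<close> is positive. Hence division by \<open>r i\<close> is legitimate.\<close>
  have rpos: "r i > 0" if "i < k" for i
    using trace[OF that] q[OF that] by (cases "r i") auto
  have sigma: "(if j < r i then sqrt (real (q i) / real (r i)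
               - 1 / \<mu> * (lam (i, j) - 1 / real (r i) * (\<Sum>l<r i. lam (i, l)))) else 0) = sqrt (g i j)"
    if ij: "i < k" "j < q i" for i j
  proof (cases "j < r i")
    case True
    have lam: "lam (i, l) = c i - \<mu> * g i l" if "l < r i" for l
      using uT[of "(i, l)"] ij that by (simp add: T_def lam0_def)
    \<comment> \<open>Only indices below \<open>r i\<close> enter here, where the eigenvalues are
      known. The trace identity gives their sum, and subtracting their mean from
      \<open>lam (i, j)\<close> eliminates \<open>c i\<close>.\<close>
    then have "(\<Sum>l<r i. lam (i, l)) = (\<Sum>l<r i. c i - \<mu> * g i l)" by simp
    also have "\<dots> = real (r i) * c i - \<mu> * real (q i)"
      using trace[OF ij(1)] by (simp add: sum_subtractf sum_distrib_left[symmetric])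
    finally have "real (q i) / real (r i) - 1 / \<mu> * (lam (i, j) - 1 / real (r i) * (\<Sum>l<r i. lam (i, l))) = g i j"
      using rpos[OF ij(1)] \<mu> by (simp add: lam[OF True] field_simps)
    then show ?thesis using True by simp
  next
    case False
    then show ?thesis using gz[OF ij] by simp
  qed
  have gnn: "g i j \<ge> 0" if "i < k" "j < q i" for i j
    using gpos[OF that(1), of j] gz[OF that] by (cases "j < r i") auto
  \<comment> \<open>The formula of the block conditions is taken as the definition;
    \<open>sigma\<close> identifies its entries with the square roots of the Gram
    eigenvalues.\<close>
  define S where "S i = mat_diag (q i) (\<lambda>j. if j < r i then sqrt (real (q i) / real (r i)
               - 1 / \<mu> * (lam (i, j) - 1 / real (r i) * (\<Sum>l<r i. lam (i, l)))) else 0)" for i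
  have S: "S i = mat_diag (q i) (\<lambda>j. sqrt (g i j))" if "i < k" for i
    unfolding S_def mat_diag_def using sigma[OF that] by (intro eq_matI) auto
  have Sc: "S i \<in> carrier_mat (q i) (q i)" for i unfolding S_def by (rule mat_diag_dim)
  let ?S = "\<lambda>i. map_mat complex_of_real (S i)"
  have cS: "?S i = mat_diag (q i) (\<lambda>j. complex_of_real (sqrt (g i j)))" if "i < k" for i
    unfolding S[OF that] map_mat_real_diag ..
  have USc: "U i * ?S i \<in> carrier_mat n (q i)" for i
    using U[of i] Sc[of i] by (metis map_carrier_mat mult_carrier_mat)
  have XV: "Xb i * V i = U i * ?S i" if i: "i < k" for i
    unfolding cS[OF i] mat_diag_mult_right[OF U]
  proof (rule eq_matI)
    fix x j
    assume "x < dim_row (mat n (q i) (\<lambda>(x, j). U i $$ (x, j) * complex_of_real (sqrt (g i j))))"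
      "j < dim_col (mat n (q i) (\<lambda>(x, j). U i $$ (x, j) * complex_of_real (sqrt (g i j))))"
    then have xj: "x < n" "j < q i" by auto
    have wx: "(Xb i * V i) $$ (x, j) = w i j $ x"
      using carrier_matD[OF W[OF i]] xj by (simp add: w_def del: index_mult_mat(1))
    have "w i j $ x = u (i, j) $ x * complex_of_real (sqrt (g i j))"
    proof (cases "j < r i")
      case True
      then have "u (i, j) = complex_of_real (1 / sqrt (g i j)) \<cdot>\<^sub>v w i j"
        using uT[of "(i, j)"] i by (simp add: T_def u0_def)
      then show ?thesis using carrier_vecD[OF w[OF i]] xj gpos[OF i True] by simp
    next
      case False
      \<comment> \<open>Here the column of \<open>Xb i * V i\<close> has length zero, so it agrees
        with zero times whichever eigenvector the completion supplied.\<close>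
      then have "g i j = 0" using gz[OF i xj(2)] by simp
      then have "w i j \<bullet>c w i j = 0" using ww[OF i xj(2) i xj(2)] by simp
      then have "w i j = 0\<^sub>v n" using conjugate_square_eq_0_vec[OF w[OF i]] by blast
      then show ?thesis using \<open>g i j = 0\<close> xj by simp
    qed
    then show "(Xb i * V i) $$ (x, j) =
        mat n (q i) (\<lambda>(x, j). U i $$ (x, j) * complex_of_real (sqrt (g i j))) $$ (x, j)"
      unfolding wx using xj by (simp add: U_def)
  qed (use carrier_matD[OF W[OF i]] in auto)
  have Xi: "Xb i = U i * ?S i * mat_adjoint (V i)" if i: "i < k" for i
  proof -
    have "U i * ?S i * mat_adjoint (V i) = Xb i * (V i * mat_adjoint (V i))"
      unfolding XV[OF i, symmetric] by (rule assoc_mult_mat[OF Xb[OF i] Vc[OF i] mat_adjoint_carrier[OF Vc[OF i]]])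
    then show ?thesis unfolding VV(1)[OF i] using Xb[OF i] by simp
  qed
  have rank: "vec_space.rank n (Xb i) = r i" if i: "i < k" for i
  proof (rule rank_reduced_svd[OF U _ V[OF i] Xi[OF i, unfolded cS[OF i]] rq[OF i]])
    show "mat_adjoint (U i) * U i = 1\<^sub>m (q i)" using UU[OF i i] by simp
    fix j assume "j < q i"
    then show "complex_of_real (sqrt (g i j)) \<noteq> 0 \<longleftrightarrow> j < r i"
      using gpos[OF i, of j] gz[OF i, of j] by (cases "j < r i") auto
  qed
  have svd: "is_svd n (q i) (Xb i) (U i) (S i) (V i)" if i: "i < k" for i
    unfolding is_svd_def
  proof (intro conjI allI impI)
    show "mat_adjoint (U i) * U i = 1\<^sub>m (q i)" using UU[OF i i] by simp
    show "diagonal_mat (S i)" unfolding S_def by (simp add: diagonal_mat_def mat_diag_def)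
    fix j assume "j < q i"
    then show "0 \<le> S i $$ (j, j)" unfolding S[OF i] using gnn[OF i] by (simp add: mat_diag_def)
  qed (use U Sc V[OF i] Xi[OF i] in auto)
  have eig: "eigenvector A (col (U i) j) (complex_of_real (lam (i, j)))" if ij: "i < k" "j < q i" for i j
  proof -
    have "u (i, j) \<noteq> 0\<^sub>v n"
      \<comment> \<open>A unit vector is nonzero, as \<open>eigenvector\<close> requires, also for
        the columns added by the completion.\<close>
      using uu[OF ij ij] conjugate_square_eq_0_vec[OF uc[OF ij]] by auto
    then show ?thesis unfolding colU[OF ij] eigenvector_def using uc[OF ij] Au[OF ij] A by simp
  qed
  have gramU: "mat_adjoint (hcat n k U) * hcat n k U = 1\<^sub>m p"
  proof -
    have "mat_adjoint (hcat n k U) * hcat n k U = block_diag k (\<lambda>i. mat_adjoint (U i) * U i)"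
      by (rule gram_hcat[of k U n q]) (use U UU in auto)
    also have "\<dots> = block_diag k (\<lambda>i. 1\<^sub>m (q i))" by (rule block_diag_cong) (use UU in auto)
    finally show ?thesis unfolding block_diag_one p .
  qed
  have adjV: "mat_adjoint (block_diag k V) = block_diag k (\<lambda>i. mat_adjoint (V i))"
    by (rule block_diag_adjoint[OF Vc])
  have gramV: "mat_adjoint (block_diag k V) * block_diag k V = 1\<^sub>m p"
  proof -
    have "mat_adjoint (block_diag k V) * block_diag k V = block_diag k (\<lambda>i. mat_adjoint (V i) * V i)"
      unfolding adjV by (rule block_diag_mult[OF mat_adjoint_carrier[OF Vc] Vc])
    also have "\<dots> = block_diag k (\<lambda>i. 1\<^sub>m (q i))" by (rule block_diag_cong) (use VV in auto)
    finally show ?thesis unfolding block_diag_one p .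
  qed
  have XUSV: "X = hcat n k U * map_mat complex_of_real (block_diag k S) * mat_adjoint (block_diag k V)"
  proof -
    have 1: "hcat n k U * block_diag k ?S = hcat n k (\<lambda>i. U i * ?S i)"
      by (rule hcat_mult_block_diag[of k U n q]) (use U Sc in auto)
    have 2: "hcat n k (\<lambda>i. U i * ?S i) * block_diag k (\<lambda>i. mat_adjoint (V i)) =
        hcat n k (\<lambda>i. U i * ?S i * mat_adjoint (V i))"
      by (rule hcat_mult_block_diag[of k _ n q, OF USc mat_adjoint_carrier[OF Vc]])
    have 3: "map_mat complex_of_real (block_diag k S) = block_diag k ?S"
      by (rule block_diag_map_mat[OF Sc])
    show ?thesis unfolding X 3 adjV 1 2 by (rule hcat_cong[OF Xi])
  qed
  have "qtpm_block_conditions A \<mu> n p X k q r Xb U S V (\<lambda>i j. lam (i, j))"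
    unfolding qtpm_block_conditions_def
    using q p[unfolded block_offset_def] Xb rank svd X XUSV gramU eig gramV V obl
    by (intro conjI allI impI S_def) auto
  then show ?thesis unfolding qtpm_block_form_def by blast
qed

section \<open>Characterisation of the stationary points\<close>

theorem theorem2p6:
  fixes n p :: nat and A :: "complex mat" and \<mu> :: real
  assumes "1 \<le> p" and "p \<le> n"
    and "A \<in> carrier_mat n n" and "hermitian A" and "negative_definite A"
    and "\<mu> > \<bar>lambda_min A\<bar>"
  shows "(\<forall>Y. qtpm_stationary A \<mu> n p Y \<longrightarrow>
            (\<exists>X P. permutation_matrix p P \<and> qtpm_block_form A \<mu> n p X \<and> Y = X * P)) \<and>
         (\<forall>X. qtpm_block_form A \<mu> n p X \<longrightarrow>
            qtpm_stationary A \<mu> n p X \<and>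
            (\<forall>P. permutation_matrix p P \<longrightarrow> qtpm_stationary A \<mu> n p (X * P)))"
proof -
  note A = assms(3) and h = assms(4)
  have \<mu>: "\<mu> > 0" using assms(6) by linarith
  have perm: "permutation_matrix p P \<longleftrightarrow> (\<exists>\<pi>. \<pi> permutes {..<p} \<and> P = perm_mat p \<pi>)" for P
    by (simp add: permutation_matrix_def perm_mat_def)
  have "\<exists>X P. permutation_matrix p P \<and> qtpm_block_form A \<mu> n p X \<and> Y = X * P"
    if Y: "qtpm_stationary A \<mu> n p Y" for Y
  proof -
    obtain \<rho> k q c Xb where \<rho>: "\<rho> permutes {..<p}" and p: "block_offset q k = p"
      and X: "Y * perm_mat p \<rho> = hcat n k Xb"
      and blocks: "\<And>i. i < k \<Longrightarrow> q i \<ge> 1" "\<And>i. i < k \<Longrightarrow> Xb i \<in> oblique n (q i)"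
        "\<And>i. i < k \<Longrightarrow> qtpm_gradient A \<mu> (Xb i) = complex_of_real (c i) \<cdot>\<^sub>m Xb i"
        "\<And>i j. i < k \<Longrightarrow> j < k \<Longrightarrow> i \<noteq> j \<Longrightarrow> mat_adjoint (Xb i) * Xb j = 0\<^sub>m (q i) (q j)"
      using stationary_decomposition[OF A h Y] by metis
    have form: "qtpm_block_form A \<mu> n p (Y * perm_mat p \<rho>)"
      by (rule block_conditions_exist[OF A h \<mu> assms(2) p X blocks])
    have Yc: "Y \<in> carrier_mat n p" using Y by (simp add: qtpm_stationary_def oblique_def)
    \<comment> \<open>The decomposition sorts the columns of \<open>Y\<close> by \<rho>, so the
      permutation matrix that recovers \<open>Y\<close> from the block form belongs to the inverse
      of \<rho>.\<close>
    have inv: "inv_into UNIV \<rho> permutes {..<p}" by (rule permutes_inv[OF \<rho>])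
    have step: "Y * perm_mat p \<rho> * perm_mat p (inv_into UNIV \<rho>) =
        mat n p (\<lambda>(x, j). (Y * perm_mat p \<rho>) $$ (x, inv_into UNIV \<rho> j))"
      by (rule mult_perm_mat[OF mult_carrier_mat[OF Yc perm_mat_carrier] inv])
    have "Y = mat n p (\<lambda>(x, j). (Y * perm_mat p \<rho>) $$ (x, inv_into UNIV \<rho> j))"
      unfolding mult_perm_mat[OF Yc \<rho>]
      using Yc permutes_in_image[OF inv] permutes_inverses(1)[OF \<rho>] by (intro eq_matI) auto
    also note step[symmetric]
    finally have "Y = Y * perm_mat p \<rho> * perm_mat p (inv_into UNIV \<rho>)" .
    with form inv show ?thesis unfolding perm by blast
  qed
  moreover have "qtpm_stationary A \<mu> n p X" if "qtpm_block_form A \<mu> n p X" for X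
    using that block_conditions_imp_stationary[OF A \<mu>] unfolding qtpm_block_form_def by blast
  moreover from this have "qtpm_stationary A \<mu> n p (X * P)"
    if "qtpm_block_form A \<mu> n p X" "permutation_matrix p P" for X P
    using that qtpm_stationary_permute[OF A] unfolding perm by blast
  ultimately show ?thesis by blast
qed

end
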